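(* Let $G = K\rtimes_f H$ be a finite Frobenius group with Frobenius kernel $K$ and Frobenius complement $H$. Then $G$ has perfect order classes if, and only if, all of the following are true: (a) $H$ has perfect order classes; (b) $K$ is a homocyclic $p$-group for an odd prime number $p$; and (c) $|H| = p^r - 1$, where $r$ is the rank of $K$.
   Context: All groups are finite. A finite group $G$ has perfect order classes if, for every positive integer $n$, the number of elements of order $n$ in $G$ is either zero or a divisor of $|G|$. A Frobenius group is a group $G$ with a proper non-trivial subgroup $H$ (a Frobenius complement) such that $H\cap H^g = 1$ for all $g\in G\setminus H$; its Frobenius kernel $K$ is the normal subgroup consisting of $1$ and all elements of $G$ lying in no conjugate of $H$, and $G$ is the semidirect product of $K$ by $H$. The notation $G = K\rtimes_f H$ means that $G$ is a Frobenius group with Frobenius kernel $K$ and Frobenius complement $H$. A homocyclic $p$-group of rank $r$ is a group isomorphic to the direct product $\mathrm{C}_{p^k}^r$ of $r$ copies of the cyclic group $\mathrm{C}_{p^k}$ of order $p^k$, for some positive integers $k$ and $r$. *)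

theory Defs
  imports
    "HOL-Algebra.Algebra"
    "HOL-Computational_Algebra.Primes"
begin

definition perfect_order_classes :: "('a, 'b) monoid_scheme \<Rightarrow> bool" where
  "perfect_order_classes G \<longleftrightarrow>
     (\<forall>n::nat. n > 0 \<longrightarrow>
        card {x \<in> carrier G. group.ord G x = n} = 0 \<or>
        card {x \<in> carrier G. group.ord G x = n} dvd order G)"

definition conjugate :: "('a, 'b) monoid_scheme \<Rightarrow> 'a set \<Rightarrow> 'a \<Rightarrow> 'a set" where
  "conjugate G H g = (inv\<^bsub>G\<^esub> g <#\<^bsub>G\<^esub> H) #>\<^bsub>G\<^esub> g"

definition frobenius_complement :: "('a, 'b) monoid_scheme \<Rightarrow> 'a set \<Rightarrow> bool" where
  "frobenius_complement G H \<longleftrightarrow>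
     subgroup H G \<and> H \<noteq> {\<one>\<^bsub>G\<^esub>} \<and> H \<noteq> carrier G \<and>
     (\<forall>g \<in> carrier G - H. H \<inter> conjugate G H g = {\<one>\<^bsub>G\<^esub>})"

definition frobenius_kernel :: "('a, 'b) monoid_scheme \<Rightarrow> 'a set \<Rightarrow> 'a set" where
  "frobenius_kernel G H =
     {\<one>\<^bsub>G\<^esub>} \<union> (carrier G - (\<Union>g \<in> carrier G. conjugate G H g))"

text \<open>
  For finite \<open>G\<close>, that the kernel is a normal subgroup, and \<open>G\<close> the semidirect product of
  the kernel by the complement, is Frobenius' theorem; it is not made part of the definition.
\<close>
definition frobenius_group :: "('a, 'b) monoid_scheme \<Rightarrow> 'a set \<Rightarrow> 'a set \<Rightarrow> bool" where
  "frobenius_group G K H \<longleftrightarrow>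
     group G \<and> frobenius_complement G H \<and> K = frobenius_kernel G H"

text \<open>
  \<open>homocyclic p r G\<close>: \<open>G\<close> is isomorphic to the direct product of \<open>r\<close> copies of the cyclic
  group of order \<open>p ^ k\<close>, for some positive \<open>k\<close>; \<open>r\<close> is the rank. For prime \<open>p\<close> the
  numbers \<open>p\<close> and \<open>r\<close> are determined by \<open>G\<close>.
\<close>
definition homocyclic :: "nat \<Rightarrow> nat \<Rightarrow> ('a, 'b) monoid_scheme \<Rightarrow> bool" where
  "homocyclic p r G \<longleftrightarrow>
     r > 0 \<and> (\<exists>k::nat. k > 0 \<and> G \<cong> product_group {..<r} (\<lambda>_. integer_mod_group (p ^ k)))"

end

theory Submission
  imports Defs
begin

text \<open>
  Put \<open>m = [G : H]\<close>. The \<open>m\<close> conjugates of \<open>H\<close> meet pairwise trivially, so \<open>|K| = m\<close>. Conjugation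
  by \<open>H\<close> permutes \<open>K - {1}\<close> without fixed points; hence \<open>m \<equiv> 1\<close> modulo \<open>|H|\<close>, every
  order class inside \<open>K\<close> other than \<open>{1}\<close> has size divisible by \<open>|H|\<close>, and a fixed point argument on
  the cosets of \<open>H\<close> shows that elements of \<open>K\<close> have order prime to \<open>|H|\<close>. An order class of \<open>G\<close>
  other than \<open>{1}\<close> therefore lies inside \<open>K\<close>, or else consists of \<open>m\<close> disjoint conjugates of
  an order class of \<open>H\<close>. So \<open>G\<close> has perfect order classes iff \<open>H\<close> has and the order classes
  in \<open>K\<close> have sizes dividing \<open>m |H|\<close> (\<open>perfect_order_classes_iff\<close>).

  Assume that \<open>G\<close> has perfect order classes. Elements of order at least \<open>3\<close> come in pairs
  \<open>{x, inv x}\<close>, so a non-trivial group with perfect order classes has even order; in particular \<open>H\<close>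
  contains an involution. Counting shows that each conjugate of \<open>H\<close> contains exactly one,
  and that \<open>K\<close> is the set of products of a fixed involution with all involutions. It follows
  that \<open>K\<close> is a subgroup inverted by every involution, hence abelian.
  If two primes \<open>p \<noteq> q\<close> divided \<open>m\<close>, the number of elements of order \<open>p q\<close>
  would be a product of two multiples of \<open>|H|\<close>, which cannot divide \<open>m |H|\<close> because \<open>|H|\<close> is
  prime to \<open>m\<close>. So \<open>K\<close> is an abelian \<open>p\<close>-group. Let \<open>T\<^sub>i\<close> consist of the solutions of
  \<open>x ^ (p ^ i) = 1\<close>. The difference \<open>|T\<^sub>i\<^sub>+\<^sub>1| - |T\<^sub>i|\<close> counts the elements of order
  \<open>p ^ (i + 1)\<close>, so below the exponent it is \<open>|H|\<close> times a power of \<open>p\<close>; comparing the parts prime to \<open>p\<close>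
  gives \<open>|T\<^sub>i\<^sub>+\<^sub>1| = (|H| + 1) |T\<^sub>i|\<close>. All layers thus have the same size \<open>|H| + 1 = p ^ r\<close>,
  which characterises the homocyclic groups of rank \<open>r\<close> (\<open>homocyclic_criterion\<close>).

  Conversely, if \<open>K\<close> is homocyclic of rank \<open>r\<close> with \<open>|H| = p ^ r - 1\<close>, then \<open>K\<close> is a Sylow subgroup and
  contains \<open>p ^ ((i + 1) r) - p ^ (i r) = p ^ (i r) |H|\<close> elements of order \<open>p ^ (i + 1)\<close>, a divisor
  of \<open>m |H|\<close>.
\<close>

section \<open>Orders and order classes in finite groups\<close>

text \<open>
  All orbits are copies of the acting group. The action is a bare function, so that the
  lemma applies at once to conjugation, to inversion and to translation of cosets.
\<close>
lemma semiregular_action_card_dvd: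
  fixes A (structure)
  assumes "group A" and "finite S"
    and closed: "\<And>a x. a \<in> carrier A \<Longrightarrow> x \<in> S \<Longrightarrow> act a x \<in> S"
    and act_one: "\<And>x. x \<in> S \<Longrightarrow> act \<one> x = x"
    and act_mult: "\<And>a b x. a \<in> carrier A \<Longrightarrow> b \<in> carrier A \<Longrightarrow> x \<in> S \<Longrightarrow>
      act (a \<otimes> b) x = act a (act b x)"
    and free: "\<And>a x. a \<in> carrier A \<Longrightarrow> x \<in> S \<Longrightarrow> act a x = x \<Longrightarrow> a = \<one>"
  shows "card (carrier A) dvd card S"
proof -
  interpret group A by fact
  define orbit where "orbit x = (\<lambda>a. act a x) ` carrier A" for x
  have orbit_eq: "orbit y = orbit x" if x: "x \<in> S" and y: "y \<in> orbit x" for x y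
  proof -
    obtain a where a: "a \<in> carrier A" "y = act a x"
      using y by (auto simp: orbit_def)
    have "act b y = act (b \<otimes> a) x" if "b \<in> carrier A" for b
      using a x that by (simp add: act_mult)
    moreover have "act b x = act (b \<otimes> inv a) y" if "b \<in> carrier A" for b
      using a x that by (simp add: m_assoc flip: act_mult)
    ultimately show ?thesis
      using a(1) unfolding orbit_def
      by (intro equalityI image_subsetI) (simp_all add: image_eqI)
  qed
  have self: "x \<in> orbit x" if "x \<in> S" for x
    using that act_one unfolding orbit_def by (metis image_eqI one_closed)
  have "inj_on (\<lambda>a. act a x) (carrier A)" if x: "x \<in> S" for x
  proof (rule inj_onI)
    fix a b
    assume ab: "a \<in> carrier A" "b \<in> carrier A" "act a x = act b x"
    have "act (inv b \<otimes> a) x = act (inv b) (act b x)"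
      unfolding ab(3)[symmetric] by (rule act_mult) (use ab x in simp_all)
    moreover have "act (inv b) (act b x) = x"
      unfolding act_mult[OF inv_closed[OF ab(2)] ab(2) x, symmetric] l_inv[OF ab(2)]
      by (rule act_one[OF x])
    ultimately have "inv b \<otimes> a = \<one>"
      by (intro free[OF _ x]) (use ab in simp_all)
    then show "a = b"
      using ab by (simp add: inv_solve_left')
  qed
  then have card_orbit: "card (orbit x) = card (carrier A)" if "x \<in> S" for x
    using that by (simp add: orbit_def card_image)
  have union: "\<Union>(orbit ` S) = S"
    using self closed by (auto simp: orbit_def)
  have "card (carrier A) * card (orbit ` S) = card (\<Union>(orbit ` S))"
  proof (rule card_partition)
    fix c1 c2
    assume "c1 \<in> orbit ` S" "c2 \<in> orbit ` S" "c1 \<noteq> c2"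
    then show "c1 \<inter> c2 = {}"
      using orbit_eq by (metis disjoint_iff imageE)
  next
    show "finite (\<Union>(orbit ` S))"
      unfolding union by fact
  qed (use \<open>finite S\<close> card_orbit in auto)
  then show ?thesis
    using union by (metis dvd_triv_left)
qed

context group
begin

lemma inv_mult_cancel [simp]:
  "x \<in> carrier G \<Longrightarrow> y \<in> carrier G \<Longrightarrow> inv x \<otimes> (x \<otimes> y) = y"
  "x \<in> carrier G \<Longrightarrow> y \<in> carrier G \<Longrightarrow> x \<otimes> (inv x \<otimes> y) = y"
  by (simp_all flip: m_assoc)

lemma ord_conj:
  assumes "g \<in> carrier G" "x \<in> carrier G"
  shows "ord (g \<otimes> x \<otimes> inv g) = ord x"
proof -
  have pow: "(g \<otimes> x \<otimes> inv g) [^] n = g \<otimes> x [^] n \<otimes> inv g" for n :: nat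
    using assms by (induction n) (simp_all add: m_assoc)
  have "g \<otimes> x [^] n \<otimes> inv g = \<one> \<longleftrightarrow> x [^] n = \<one>" for n :: nat
    using assms by (simp add: inv_solve_right')
  then show ?thesis
    using assms by (simp add: ord_unique[of "g \<otimes> x \<otimes> inv g"] pow flip: pow_eq_id)
qed

lemma ord_subgroup:
  assumes "subgroup A G" "x \<in> A"
  shows "group.ord (G\<lparr>carrier := A\<rparr>) x = ord x"
proof -
  interpret A: group "G\<lparr>carrier := A\<rparr>"
    by (rule subgroup_imp_group) fact
  have "x \<in> carrier G"
    using assms by (simp add: subgroup.mem_carrier)
  then have "x [^]\<^bsub>G\<lparr>carrier := A\<rparr>\<^esub> n = \<one>\<^bsub>G\<lparr>carrier := A\<rparr>\<^esub> \<longleftrightarrow> ord x dvd n" for n :: nat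
    by (simp add: pow_eq_id flip: nat_pow_consistent)
  then show ?thesis
    using assms by (subst A.ord_unique) simp_all
qed

lemma cauchy:
  assumes "finite (carrier G)" "Factorial_Ring.prime p" "p dvd order G"
  obtains x where "x \<in> carrier G" "ord x = p"
proof -
  obtain m where "order G = p ^ 1 * m"
    using assms(3) by auto
  then obtain P where P: "subgroup P G" "card P = p ^ 1"
    using sylow_thm assms is_group by blast
  have "P \<noteq> {\<one>}"
    using P assms(2) by auto
  then obtain x where x: "x \<in> P" "x \<noteq> \<one>"
    using subgroup.one_closed[OF P(1)] by auto
  interpret P: group "G\<lparr>carrier := P\<rparr>"
    by (rule subgroup_imp_group) fact
  have xG: "x \<in> carrier G"
    using P x by (simp add: subgroup.mem_carrier)
  have "ord x dvd p"
    using P.ord_dvd_group_order[of x] x P by (simp add: ord_subgroup order_def)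
  moreover have "ord x \<noteq> 1"
    using x xG ord_eq_1 by blast
  ultimately have "ord x = p"
    using assms(2) prime_nat_iff by blast
  then show ?thesis
    using xG that by blast
qed

text \<open>
  Inversion acts on the order class as a group of order two, and it is fixed-point free
  because an element equal to its inverse has order at most two.
\<close>
lemma even_card_ord:
  assumes "finite (carrier G)" "n > 2"
  shows "even (card {x \<in> carrier G. ord x = n})"
proof -
  let ?S = "{x \<in> carrier G. ord x = n}"
  have "inv x \<noteq> x" if "x \<in> ?S" for x
  proof
    assume "inv x = x"
    with that have "x \<otimes> x = \<one>"
      using r_inv[of x] by simp
    with that have "x [^] (2::nat) = \<one>"
      by (simp add: numeral_2_eq_2)
    with that have "n dvd 2"
      using pow_eq_id by blast
    with assms show False
      by (auto dest: dvd_imp_le)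
  qed
  moreover have two: "a = 0 \<or> a = 1" if "a \<in> carrier (integer_mod_group 2)" for a
    using that by (auto simp: carrier_integer_mod_group)
  ultimately have "card (carrier (integer_mod_group 2)) dvd card ?S"
  proof (intro semiregular_action_card_dvd[where act = "\<lambda>a x. if a = 0 then x else inv x"])
    fix a b x
    assume "a \<in> carrier (integer_mod_group 2)" "b \<in> carrier (integer_mod_group 2)" "x \<in> ?S"
    then show "(if a \<otimes>\<^bsub>integer_mod_group 2\<^esub> b = 0 then x else inv x) =
        (if a = 0 then if b = 0 then x else inv x else inv (if b = 0 then x else inv x))"
      using two[of a] two[of b] by auto
  qed (use assms in \<open>auto split: if_splits\<close>)
  then show ?thesis
    by (simp add: carrier_integer_mod_group)
qed

text \<open>
  An odd prime divisor \<open>q\<close> of the order already forces the order to be even, through the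
  class of elements of order \<open>q\<close>.
\<close>
lemma perfect_order_classes_even:
  assumes "finite (carrier G)" "carrier G \<noteq> {\<one>}" "perfect_order_classes G"
  shows "even (order G)"
proof -
  have "order G \<noteq> 1"
    using assms order_one_triv_iff by blast
  then obtain q where q: "Factorial_Ring.prime q" "q dvd order G"
    using prime_factor_nat by blast
  then obtain x where x: "x \<in> carrier G" "ord x = q"
    using cauchy assms(1) by blast
  let ?c = "card {x \<in> carrier G. ord x = q}"
  have "?c \<noteq> 0"
    using x assms(1) by auto
  moreover have "q > 0 \<longrightarrow> ?c = 0 \<or> ?c dvd order G"
    using assms(3) unfolding perfect_order_classes_def by (rule spec)
  ultimately have "?c dvd order G"
    using prime_gt_0_nat[OF q(1)] by simp
  moreover have "even ?c" if "q \<noteq> 2"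
    using even_card_ord[OF assms(1)] q that prime_ge_2_nat[of q] by auto
  ultimately show ?thesis
    using q dvd_trans[of 2 ?c "order G"] by (cases "q = 2") simp_all
qed

end

section \<open>Order classes of a Frobenius group\<close>

text \<open>
  Only the set \<open>K\<close> is given here: that it is a subgroup is proved later, separately in the two
  situations where it is needed.
\<close>
locale finite_frobenius_group = group G for G (structure) +
  fixes H K :: "'a set"
  assumes finite_carrier: "finite (carrier G)"
    and complement: "frobenius_complement G H"
    and kernel: "K = frobenius_kernel G H"
begin

abbreviation index :: nat where "index \<equiv> card (rcosets H)"

lemma subgroup_H: "subgroup H G"
  using complement by (simp add: frobenius_complement_def)

lemma H_carrier [simp]: "h \<in> H \<Longrightarrow> h \<in> carrier G"
  using subgroup_H by (rule subgroup.mem_carrier)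

lemma one_H [simp]: "\<one> \<in> H"
  using subgroup_H by (rule subgroup.one_closed)

lemma finite_H [simp]: "finite H"
  using finite_carrier H_carrier by (meson finite_subset subsetI)

lemma conjugate_iff:
  assumes "g \<in> carrier G"
  shows "x \<in> conjugate G H g \<longleftrightarrow> x \<in> carrier G \<and> g \<otimes> x \<otimes> inv g \<in> H"
proof
  assume "x \<in> conjugate G H g"
  then obtain h where "h \<in> H" "x = inv g \<otimes> h \<otimes> g"
    by (auto simp: conjugate_def l_coset_def r_coset_def)
  with assms show "x \<in> carrier G \<and> g \<otimes> x \<otimes> inv g \<in> H"
    by (simp add: m_assoc)
next
  assume x: "x \<in> carrier G \<and> g \<otimes> x \<otimes> inv g \<in> H"
  with assms have "x = inv g \<otimes> (g \<otimes> x \<otimes> inv g) \<otimes> g"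
    by (simp add: m_assoc)
  with x show "x \<in> conjugate G H g"
    by (auto simp: conjugate_def l_coset_def r_coset_def)
qed

lemma malnormal:
  assumes "g \<in> carrier G" "h \<in> H" "h \<noteq> \<one>" "g \<otimes> h \<otimes> inv g \<in> H"
  shows "g \<in> H"
proof (rule ccontr)
  assume "g \<notin> H"
  then have "H \<inter> conjugate G H g = {\<one>}"
    using complement assms(1) by (simp add: frobenius_complement_def)
  moreover have "h \<in> H \<inter> conjugate G H g"
    using assms by (simp add: conjugate_iff)
  ultimately show False
    using assms(3) by auto
qed

text \<open>
  The transport of \<open>malnormal\<close> to the conjugate of \<open>H\<close> by \<open>g\<close>: whatever moves a
  non-trivial element of it inside it belongs to it.
\<close>
lemma malnormal_conj:
  assumes "g \<in> carrier G" "y \<in> carrier G" "x \<in> carrier G" "x \<noteq> \<one>"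
    and "g \<otimes> x \<otimes> inv g \<in> H" "g \<otimes> (y \<otimes> x \<otimes> inv y) \<otimes> inv g \<in> H"
  shows "g \<otimes> y \<otimes> inv g \<in> H"
proof (rule malnormal[where h = "g \<otimes> x \<otimes> inv g"])
  show "(g \<otimes> y \<otimes> inv g) \<otimes> (g \<otimes> x \<otimes> inv g) \<otimes> inv (g \<otimes> y \<otimes> inv g) \<in> H"
    using assms by (simp add: m_assoc inv_mult_group)
  show "g \<otimes> x \<otimes> inv g \<noteq> \<one>"
    using assms by (simp add: inv_solve_right')
qed (use assms in auto)

text \<open>
  Conjugates of \<open>H\<close> that share a non-trivial element come from the same right coset of \<open>H\<close>,
  so the right cosets index the conjugates without repetition.
\<close>
lemma conjugates_meet:
  assumes "g \<in> carrier G" "g' \<in> carrier G" "x \<in> carrier G" "x \<noteq> \<one>"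
    and "g \<otimes> x \<otimes> inv g \<in> H" "g' \<otimes> x \<otimes> inv g' \<in> H"
  shows "g' \<otimes> inv g \<in> H"
proof (rule malnormal[where h = "g \<otimes> x \<otimes> inv g"])
  show "(g' \<otimes> inv g) \<otimes> (g \<otimes> x \<otimes> inv g) \<otimes> inv (g' \<otimes> inv g) \<in> H"
    using assms by (simp add: m_assoc inv_mult_group)
  show "g \<otimes> x \<otimes> inv g \<noteq> \<one>"
    using assms by (simp add: inv_solve_right')
qed (use assms in auto)

lemma kernel_iff:
  "x \<in> K \<longleftrightarrow> x \<in> carrier G \<and> (x = \<one> \<or> (\<forall>g\<in>carrier G. g \<otimes> x \<otimes> inv g \<notin> H))"
  unfolding kernel frobenius_kernel_def by (auto simp: conjugate_iff)

lemma K_carrier: "x \<in> K \<Longrightarrow> x \<in> carrier G"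
  by (simp add: kernel_iff)

lemma one_K [simp]: "\<one> \<in> K"
  by (simp add: kernel_iff)

lemma finite_K [simp]: "finite K"
  using finite_carrier K_carrier by (meson finite_subset subsetI)

lemma H_Int_K: "x \<in> H \<Longrightarrow> x \<in> K \<Longrightarrow> x = \<one>"
  unfolding kernel_iff using one_closed by fastforce

lemma conj_in_kernel:
  assumes "x \<in> K" "g \<in> carrier G"
  shows "g \<otimes> x \<otimes> inv g \<in> K"
proof -
  have "g' \<otimes> (g \<otimes> x \<otimes> inv g) \<otimes> inv g' = (g' \<otimes> g) \<otimes> x \<otimes> inv (g' \<otimes> g)" if "g' \<in> carrier G" for g'
    using assms that K_carrier[OF assms(1)] by (simp add: m_assoc inv_mult_group)
  then show ?thesis
    using assms by (auto simp: kernel_iff)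
qed

text \<open>
  Outside \<open>K\<close> the group is the disjoint union of the non-trivial parts of the conjugates of \<open>H\<close>, and
  an invariant property selects equally many elements in each.
\<close>
lemma card_outside_kernel:
  assumes inv: "\<And>g x. g \<in> carrier G \<Longrightarrow> x \<in> carrier G \<Longrightarrow> P (g \<otimes> x \<otimes> inv g) \<longleftrightarrow> P x"
  shows "card {x \<in> carrier G - K. P x} = index * card {h \<in> H - {\<one>}. P h}"
proof -
  let ?S = "{h \<in> H - {\<one>}. P h}"
  \<comment> \<open>\<open>D R\<close> is the part belonging to the conjugates by elements of the coset \<open>R\<close>; these conjugates all coincide.\<close>
  define D where "D R = {x \<in> carrier G - K. P x \<and> (\<exists>g\<in>R. g \<otimes> x \<otimes> inv g \<in> H)}" for R
  have R: "R \<subseteq> carrier G" if "R \<in> rcosets H" for R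
    using that subgroup_H rcosets_part_G by blast
  have coset: "R = H #> g" if Rg: "R \<in> rcosets H" "g \<in> R" for R g
  proof -
    obtain x where "x \<in> carrier G" "R = H #> x"
      using Rg by (auto simp: RCOSETS_def)
    with Rg show ?thesis
      using repr_independence[OF _ _ subgroup_H] by simp
  qed
  have card_D: "card (D R) = card ?S" if RH: "R \<in> rcosets H" for R
  proof -
    obtain g where g: "g \<in> carrier G" "R = H #> g"
      using RH by (auto simp: RCOSETS_def)
    have gR: "g \<in> R"
      using g subgroup_H rcos_self by simp
    have "g \<otimes> x \<otimes> inv g \<in> ?S" if xD: "x \<in> D R" for x
    proof -
      obtain g' where g': "g' \<in> R" "g' \<otimes> x \<otimes> inv g' \<in> H" and x: "x \<in> carrier G" "x \<notin> K" "P x"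
        using xD by (auto simp: D_def)
      obtain h where h: "h \<in> H" "g' = h \<otimes> g"
        using g'(1) g by (auto simp: r_coset_def)
      have "g \<otimes> x \<otimes> inv g = inv h \<otimes> (g' \<otimes> x \<otimes> inv g') \<otimes> h"
        using h g x by (simp add: m_assoc inv_mult_group)
      also have "\<dots> \<in> H"
        using h g' subgroup_H by (simp add: subgroup.m_closed subgroup.m_inv_closed)
      finally have "g \<otimes> x \<otimes> inv g \<in> H" .
      moreover have "g \<otimes> x \<otimes> inv g \<noteq> \<one>"
        using x g by (auto simp: inv_solve_right' kernel_iff)
      ultimately show ?thesis
        using x g inv by simp
    qed
    moreover have "inv g \<otimes> h \<otimes> g \<in> D R \<and> g \<otimes> (inv g \<otimes> h \<otimes> g) \<otimes> inv g = h" if h: "h \<in> ?S" for h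
    proof -
      have eq: "g \<otimes> (inv g \<otimes> h \<otimes> g) \<otimes> inv g = h"
        using h g by (simp add: m_assoc)
      then have mem: "g \<otimes> (inv g \<otimes> h \<otimes> g) \<otimes> inv g \<in> H"
        using h by simp
      have "inv g \<otimes> h \<otimes> g \<noteq> \<one>"
        using h g eq by auto
      moreover have "P (inv g \<otimes> h \<otimes> g)"
        using h g inv[of g "inv g \<otimes> h \<otimes> g"] eq by simp
      moreover have "inv g \<otimes> h \<otimes> g \<notin> K"
        using calculation g mem by (simp only: kernel_iff) blast
      moreover have "inv g \<otimes> h \<otimes> g \<in> carrier G"
        using h g by simp
      ultimately have "inv g \<otimes> h \<otimes> g \<in> D R"
        using h g gR mem unfolding D_def by blast
      with eq show ?thesis
        by blast
    qed
    ultimately have "bij_betw (\<lambda>x. g \<otimes> x \<otimes> inv g) (D R) ?S"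
      using g by (intro bij_betw_byWitness[where f' = "\<lambda>h. inv g \<otimes> h \<otimes> g"])
        (auto simp: D_def m_assoc)
    then show ?thesis
      by (rule bij_betw_same_card)
  qed
  have "{x \<in> carrier G - K. P x} = (\<Union>R\<in>rcosets H. D R)"
  proof (intro equalityI subsetI)
    fix x
    assume x: "x \<in> {x \<in> carrier G - K. P x}"
    then obtain g where "g \<in> carrier G" "g \<otimes> x \<otimes> inv g \<in> H"
      by (auto simp: kernel_iff)
    moreover from this have "H #> g \<in> rcosets H" "g \<in> H #> g"
      using rcosetsI[OF subgroup.subset[OF subgroup_H]] rcos_self[OF _ subgroup_H] by auto
    ultimately show "x \<in> (\<Union>R\<in>rcosets H. D R)"
      using x by (auto simp: D_def)
  qed (auto simp: D_def)
  also have "card \<dots> = (\<Sum>R\<in>rcosets H. card (D R))"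
  proof (rule card_UN_disjoint)
    show "finite (rcosets H)"
      using finite_carrier rcosets_subset_PowG[OF subgroup_H] by (meson finite_Pow_iff finite_subset)
    show "\<forall>R\<in>rcosets H. finite (D R)"
      using finite_carrier by (auto simp: D_def)
    show "\<forall>R\<in>rcosets H. \<forall>R'\<in>rcosets H. R \<noteq> R' \<longrightarrow> D R \<inter> D R' = {}"
    proof (intro ballI impI equals0I)
      fix R R' x
      assume RR': "R \<in> rcosets H" "R' \<in> rcosets H" "R \<noteq> R'" "x \<in> D R \<inter> D R'"
      then obtain g g' where g: "g \<in> R" "g \<otimes> x \<otimes> inv g \<in> H" "g' \<in> R'" "g' \<otimes> x \<otimes> inv g' \<in> H"
        and x: "x \<in> carrier G" "x \<notin> K"
        by (auto simp: D_def)
      then have gG: "g \<in> carrier G" "g' \<in> carrier G"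
        using R RR' by auto
      have "g' \<otimes> inv g \<in> H"
        using conjugates_meet[of g g' x] g gG x one_K by metis
      then have "g' \<in> H #> g"
        using gG subgroup.rcos_module[OF subgroup_H is_group, of g g'] by simp
      then have "g' \<in> R"
        using coset[of R g] RR'(1) g(1) by simp
      then show False
        using coset RR' g by metis
    qed
  qed
  also have "\<dots> = index * card ?S"
    by (simp add: card_D)
  finally show ?thesis .
qed

lemma order_G: "order G = index * card H"
  using lagrange[OF subgroup_H] by simp

lemma index_pos: "index > 0"
  using order_G finite_carrier order_gt_0_iff_finite by (metis gr0I mult_is_0 less_irrefl)

lemma card_H_gt_1: "card H > 1"
proof -
  have "card H \<noteq> 0"
    using one_H finite_H by (metis card_eq_0_iff empty_iff)
  moreover have "card H \<noteq> 1"
    using complement one_H unfolding frobenius_complement_def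
    by (metis card_1_singletonE singletonD)
  ultimately show ?thesis
    by linarith
qed

lemma index_gt_1: "index > 1"
proof -
  have "index \<noteq> 1"
  proof
    assume "index = 1"
    then have "card H = card (carrier G)"
      using order_G by (simp add: order_def)
    then have "H = carrier G"
      using finite_carrier by (metis H_carrier card_subset_eq subsetI)
    then show False
      using complement by (simp add: frobenius_complement_def)
  qed
  then show ?thesis
    using index_pos by linarith
qed

lemma card_K: "card K = index"
proof -
  have "card {x \<in> carrier G - K. True} = index * card {h \<in> H - {\<one>}. True}"
    by (rule card_outside_kernel) simp
  then have "card (carrier G - K) = index * card (H - {\<one>})"
    by (simp only: simp_thms Collect_mem_eq)
  then have "card (carrier G - K) = index * (card H - 1)"
    by (simp add: card_Diff_singleton)
  moreover have "card (carrier G - K) = order G - card K"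
    using K_carrier by (simp add: card_Diff_subset order_def subset_iff)
  moreover have "card K \<le> order G"
    using finite_carrier K_carrier by (auto simp: order_def intro: card_mono)
  moreover have "index * card H = index * (card H - 1) + index"
    using card_H_gt_1 by (cases "card H") simp_all
  ultimately show ?thesis
    using order_G by linarith
qed

text \<open>
  If \<open>h\<close> in \<open>H\<close> fixes \<open>x\<close>, then \<open>x\<close> fixes \<open>h\<close>; for \<open>h \<noteq> 1\<close> this puts \<open>x\<close> into \<open>H\<close>.
  So \<open>H\<close> acts semiregularly on the non-trivial elements of \<open>K\<close>.
\<close>
lemma card_H_dvd_card_kernel_part:
  assumes "S \<subseteq> K - {\<one>}" and "\<And>h x. h \<in> H \<Longrightarrow> x \<in> S \<Longrightarrow> h \<otimes> x \<otimes> inv h \<in> S"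
  shows "card H dvd card S"
proof -
  have "card (carrier (G\<lparr>carrier := H\<rparr>)) dvd card S"
  proof (rule semiregular_action_card_dvd[where act = "\<lambda>h x. h \<otimes> x \<otimes> inv h"])
    show "group (G\<lparr>carrier := H\<rparr>)"
      by (rule subgroup_imp_group[OF subgroup_H])
    show "finite S"
      using assms(1) by (meson finite_Diff finite_K finite_subset)
  next
    fix h x
    assume hx: "h \<in> carrier (G\<lparr>carrier := H\<rparr>)" "x \<in> S" "h \<otimes> x \<otimes> inv h = x"
    then have x: "x \<in> K" "x \<noteq> \<one>"
      using assms(1) by auto
    show "h = \<one>\<^bsub>G\<lparr>carrier := H\<rparr>\<^esub>"
    proof (rule ccontr)
      assume h: "h \<noteq> \<one>\<^bsub>G\<lparr>carrier := H\<rparr>\<^esub>"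
      have "x \<otimes> h \<otimes> inv x = h"
        using hx x by (metis H_carrier K_carrier inv_solve_right' m_closed partial_object.select_convs(1)
            partial_object.surjective partial_object.update_convs(1))
      then have "x \<in> H"
        using malnormal[of x h] K_carrier[of x] hx x h by simp
      then show False
        using x H_Int_K by blast
    qed
  qed (use assms K_carrier in \<open>auto simp: m_assoc inv_mult_group subset_eq\<close>)
  then show ?thesis
    by simp
qed

lemma card_H_dvd_card_kernel_ord:
  assumes "n \<noteq> 1"
  shows "card H dvd card {x \<in> K. ord x = n}"
  using assms by (intro card_H_dvd_card_kernel_part) (auto simp: conj_in_kernel ord_conj K_carrier)

text \<open>
  Taking all of \<open>K - {1}\<close> in \<open>card_H_dvd_card_kernel_part\<close> shows that the index is \<open>1\<close> modulo \<open>|H|\<close>.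
\<close>
lemma coprime_card_H_index: "coprime (card H) index"
proof -
  have "card H dvd card (K - {\<one>})"
    by (rule card_H_dvd_card_kernel_part)
       (auto simp: K_carrier conj_in_kernel inv_solve_right')
  then have "card H dvd index - 1"
    by (simp add: card_Diff_singleton card_K)
  moreover have "coprime (index - 1) index"
    using index_gt_1 by (intro coprime_diff_one_left_nat) linarith
  ultimately show ?thesis
    by (rule coprime_divisors[OF _ dvd_refl])
qed

text \<open>
  A conjugate of \<open>H\<close> contains the centralizers of its non-trivial elements, so commuting
  non-trivial elements lie both in \<open>K\<close> or both outside.
\<close>
lemma centralizer_of_non_kernel:
  assumes "x \<in> K" "x \<noteq> \<one>" "y \<in> carrier G" "y \<noteq> \<one>" "x \<otimes> y = y \<otimes> x"
  shows "y \<in> K"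
proof (rule ccontr)
  assume "y \<notin> K"
  then obtain g where g: "g \<in> carrier G" "g \<otimes> y \<otimes> inv g \<in> H"
    using assms by (auto simp: kernel_iff)
  have "x \<otimes> y \<otimes> inv x = y"
    using assms K_carrier[OF assms(1)] by (simp add: m_assoc)
  then have "g \<otimes> x \<otimes> inv g \<in> H"
    using malnormal_conj[of g x y] g assms K_carrier[OF assms(1)] by simp
  then show False
    using assms g by (auto simp: kernel_iff)
qed

text \<open>
  If a prime \<open>q\<close> divided both numbers, some power \<open>y\<close> of \<open>x\<close> would have order \<open>q\<close> and
  lie in \<open>K\<close>. A power of \<open>y\<close> that fixes the coset \<open>H g\<close> lies in a conjugate of \<open>H\<close>, so the powers of \<open>y\<close>
  act semiregularly on the right cosets of \<open>H\<close>, and \<open>q\<close> divides their number; but that number is prime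
  to \<open>|H|\<close>.
\<close>
lemma coprime_ord_kernel:
  assumes "x \<in> K"
  shows "coprime (ord x) (card H)"
proof (rule ccontr)
  assume "\<not> coprime (ord x) (card H)"
  then obtain q where q: "Factorial_Ring.prime q" "q dvd ord x" "q dvd card H"
    using prime_factor_nat[of "gcd (ord x) (card H)"] by (auto simp: coprime_iff_gcd_eq_1)
  have x: "x \<in> carrier G" "x \<noteq> \<one>"
    using K_carrier[OF assms] q by auto
  have ord_x: "ord x > 0"
    using x finite_carrier ord_ge_1 by (simp add: Suc_le_eq)
  define y where "y = x [^] (ord x div q)"
  have y: "y \<in> carrier G" "ord y = q"
    unfolding y_def using x q ord_x prime_gt_0_nat[OF q(1)]
    by (auto simp: ord_pow elim!: dvdE)
  have q1: "q > 1"
    using q(1) prime_gt_1_nat by blast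
  have y_pow: "y [^] a \<noteq> \<one>" if "0 < a" "a < int q" for a :: int
    using that y by (simp add: int_pow_eq_id zdvd_not_zless)
  have y_ne: "y \<noteq> \<one>"
    using y q1 by auto
  have yK: "y \<in> K"
  proof (rule centralizer_of_non_kernel[of x])
    show "x \<otimes> y = y \<otimes> x"
      unfolding y_def using x nat_pow_comm[of x 1 "ord x div q"] by simp
  qed (use assms x y y_ne in auto)
  have rc: "R \<subseteq> carrier G" if "R \<in> rcosets H" for R
    using that subgroup_H rcosets_part_G by blast
  have "card (carrier (integer_mod_group q)) dvd index"
  proof (rule semiregular_action_card_dvd[where act = "\<lambda>a R. R #> y [^] a"])
    show "group (integer_mod_group q)"
      by simp
    show "finite (rcosets H)"
      using index_pos card_gt_0_iff by blast
    show "R #> y [^] a \<in> rcosets H" if "R \<in> rcosets H" for a :: int and R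
      using that y subgroup_H subgroup.subset[OF subgroup_H]
      by (auto simp: RCOSETS_def coset_mult_assoc)
    show "R #> y [^] \<one>\<^bsub>integer_mod_group q\<^esub> = R" if "R \<in> rcosets H" for R
      using that rc by (simp add: coset_mult_one)
    show "R #> y [^] (a \<otimes>\<^bsub>integer_mod_group q\<^esub> b) = R #> y [^] b #> y [^] a"
      if "R \<in> rcosets H" for a b R
    proof -
      have "y [^] ((a + b) mod int q) = y [^] (b + a)"
        using y by (simp add: int_pow_eq add.commute mod_eq_dvd_iff[symmetric])
      then show ?thesis
        using that rc y by (simp add: coset_mult_assoc int_pow_mult)
    qed
    show "a = \<one>\<^bsub>integer_mod_group q\<^esub>"
      if a: "a \<in> carrier (integer_mod_group q)" and R: "R \<in> rcosets H" "R #> y [^] a = R" for a R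
    proof (rule ccontr)
      assume "a \<noteq> \<one>\<^bsub>integer_mod_group q\<^esub>"
      then have "y [^] a \<noteq> \<one>"
        using a y_pow[of a] q1 by (simp add: carrier_integer_mod_group split: if_splits)
      moreover have "y \<otimes> y [^] a = y [^] a \<otimes> y"
        using y int_pow_mult[of y a 1] int_pow_mult[of y 1 a] add.commute[of a 1] by simp
      ultimately have "y [^] a \<in> K"
        using centralizer_of_non_kernel[OF yK y_ne, of "y [^] a"] y by simp
      obtain g where g: "g \<in> carrier G" "R = H #> g"
        using R by (auto simp: RCOSETS_def)
      then have "H #> (g \<otimes> y [^] a) = H #> g"
        using R y subgroup.subset[OF subgroup_H] by (simp add: coset_mult_assoc)
      then have "g \<otimes> y [^] a \<in> H #> g"
        using rcos_self[OF _ subgroup_H, of "g \<otimes> y [^] a"] g y by simp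
      then have "g \<otimes> y [^] a \<otimes> inv g \<in> H"
        using subgroup.rcos_module[OF subgroup_H is_group, of g] g y by simp
      then show False
        using \<open>y [^] a \<in> K\<close> \<open>y [^] a \<noteq> \<one>\<close> g by (simp add: kernel_iff)
    qed
  qed
  then have "q dvd index"
    using q1 by (simp add: carrier_integer_mod_group split: if_splits)
  then have "is_unit q"
    using coprime_common_divisor[OF coprime_card_H_index q(3)] by blast
  then show False
    using q1 by simp
qed

lemma card_order_class:
  assumes "n \<noteq> 1"
  shows "card {x \<in> carrier G. ord x = n} =
    card {x \<in> K. ord x = n} + index * card {h \<in> H. ord h = n}"
proof -
  have "{x \<in> carrier G. ord x = n} = {x \<in> K. ord x = n} \<union> {x \<in> carrier G - K. ord x = n}"
    using K_carrier by blast
  then have "card {x \<in> carrier G. ord x = n} =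
      card {x \<in> K. ord x = n} + card {x \<in> carrier G - K. ord x = n}"
    using finite_carrier by (simp add: card_Un_disjoint disjoint_iff)
  also have "card {x \<in> carrier G - K. ord x = n} = index * card {h \<in> H - {\<one>}. ord h = n}"
    by (rule card_outside_kernel) (simp add: ord_conj)
  also have "{h \<in> H - {\<one>}. ord h = n} = {h \<in> H. ord h = n}"
    using assms by auto
  finally show ?thesis .
qed

lemma ord_H_dvd:
  assumes "h \<in> H"
  shows "ord h dvd card H"
proof -
  interpret H: group "G\<lparr>carrier := H\<rparr>"
    by (rule subgroup_imp_group[OF subgroup_H])
  show ?thesis
    using H.ord_dvd_group_order[of h] assms by (simp add: ord_subgroup[OF subgroup_H] order_def)
qed

text \<open>
  Orders in \<open>K\<close> are prime to orders in \<open>H\<close>, so for \<open>n > 1\<close> at most one of the two summands in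
  \<open>card_order_class\<close> is non-zero, and the condition for \<open>G\<close> splits.
\<close>
lemma perfect_order_classes_iff:
  "perfect_order_classes G \<longleftrightarrow> perfect_order_classes (G\<lparr>carrier := H\<rparr>) \<and>
    (\<forall>n>1. card {x \<in> K. ord x = n} = 0 \<or> card {x \<in> K. ord x = n} dvd index * card H)"
proof -
  define g h k where
    "g n = card {x \<in> carrier G. ord x = n}" and
    "h n = card {x \<in> H. ord x = n}" and
    "k n = card {x \<in> K. ord x = n}" for n
  have H_class: "card {x \<in> carrier (G\<lparr>carrier := H\<rparr>). group.ord (G\<lparr>carrier := H\<rparr>) x = n} = h n" for n
    unfolding h_def by (rule arg_cong[where f = card]) (auto simp: ord_subgroup[OF subgroup_H])
  have order_H: "order (G\<lparr>carrier := H\<rparr>) = card H"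
    by (simp add: order_def)
  have disj: "k n = 0 \<or> h n = 0" if "n > 1" for n
  proof (rule ccontr)
    assume "\<not> (k n = 0 \<or> h n = 0)"
    then obtain x y where "x \<in> K" "ord x = n" "y \<in> H" "ord y = n"
      by (auto simp: card_eq_0_iff h_def k_def)
    then have "coprime n n"
      using coprime_ord_kernel[of x] ord_H_dvd[of y] coprime_divisors[of n n n "card H"] by simp
    then show False
      using that by simp
  qed
  have one: "g 1 = 1" "h 1 = 1"
  proof -
    have "{x \<in> carrier G. ord x = 1} = {\<one>}" "{x \<in> H. ord x = 1} = {\<one>}"
      by (auto simp: ord_eq_1[unfolded One_nat_def])
    then show "g 1 = 1" "h 1 = 1"
      unfolding g_def h_def by simp_all
  qed
  have key: "(g n = 0 \<or> g n dvd order G) \<longleftrightarrow>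
      (h n = 0 \<or> h n dvd card H) \<and> (k n = 0 \<or> k n dvd index * card H)" if "n > 1" for n
  proof -
    have "g n = k n + index * h n"
      unfolding g_def h_def k_def using that by (intro card_order_class) simp
    then show ?thesis
      using disj[OF that] index_pos by (auto simp: order_G)
  qed
  show ?thesis
    unfolding perfect_order_classes_def H_class order_H g_def[symmetric] k_def[symmetric]
  proof (intro iffI conjI allI impI)
    fix n :: nat
    assume G: "\<forall>n>0. g n = 0 \<or> g n dvd order G"
    show "h n = 0 \<or> h n dvd card H" if "n > 0"
      using G key[of n] one that by (cases "n = 1") auto
    show "k n = 0 \<or> k n dvd index * card H" if "n > 1"
      using G key[of n] that by auto
  next
    fix n :: nat
    assume HK: "(\<forall>n>0. h n = 0 \<or> h n dvd card H) \<and> (\<forall>n>1. k n = 0 \<or> k n dvd index * card H)"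
      and "n > 0"
    then show "g n = 0 \<or> g n dvd order G"
      using key[of n] one by (cases "n = 1") auto
  qed
qed

end

section \<open>Complements of even order have abelian kernels\<close>

locale even_frobenius_group = finite_frobenius_group +
  assumes even_H: "even (card H)"
begin

definition involutions :: "'a set" where
  "involutions = {t \<in> carrier G. ord t = 2}"

lemma involution_closed [simp]: "t \<in> involutions \<Longrightarrow> t \<in> carrier G"
  by (simp add: involutions_def)

lemma involution_neq_one: "t \<in> involutions \<Longrightarrow> t \<noteq> \<one>"
  unfolding involutions_def by auto

lemma involution_square [simp]: "t \<in> involutions \<Longrightarrow> t \<otimes> t = \<one>"
  using pow_ord_eq_1[of t] unfolding involutions_def by (simp add: numeral_2_eq_2)

lemma involution_cancel [simp]:
  "t \<in> involutions \<Longrightarrow> x \<in> carrier G \<Longrightarrow> t \<otimes> (t \<otimes> x) = x"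
  by (simp flip: m_assoc)

lemma inv_involution [simp]: "t \<in> involutions \<Longrightarrow> inv t = t"
  by (rule inv_equality) simp_all

lemma conj_involution: "g \<in> carrier G \<Longrightarrow> t \<in> involutions \<Longrightarrow> g \<otimes> t \<otimes> inv g \<in> involutions"
  unfolding involutions_def by (simp add: ord_conj)

lemma finite_involutions [simp]: "finite involutions"
  using finite_carrier unfolding involutions_def by simp

lemma kernel_no_involution: "involutions \<inter> K = {}"
  using coprime_ord_kernel even_H unfolding involutions_def by fastforce

lemma card_involutions: "card involutions = index * card (involutions \<inter> H)"
proof -
  have "{x \<in> K. ord x = 2} = {}"
    using kernel_no_involution K_carrier unfolding involutions_def by auto
  moreover have "involutions \<inter> H = {h \<in> H. ord h = 2}"
    unfolding involutions_def by auto
  ultimately show ?thesis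
    using card_order_class[of 2] unfolding involutions_def by simp
qed

text \<open>
  Both involutions invert their product. When it is a non-trivial element of a conjugate of \<open>H\<close>,
  malnormality therefore puts both of them into that conjugate.
\<close>
lemma mult_involutions_outside_kernel:
  assumes "t \<in> involutions" "s \<in> involutions" "t \<otimes> s \<notin> K"
  obtains g where "g \<in> carrier G" "g \<otimes> t \<otimes> inv g \<in> H" "g \<otimes> s \<otimes> inv g \<in> H"
proof -
  let ?u = "t \<otimes> s"
  obtain g where g: "g \<in> carrier G" "g \<otimes> ?u \<otimes> inv g \<in> H" and u: "?u \<noteq> \<one>"
    using assms by (auto simp: kernel_iff)
  have "inv (g \<otimes> ?u \<otimes> inv g) \<in> H"
    using g subgroup_H by (simp add: subgroup.m_inv_closed)
  then have "g \<otimes> (t \<otimes> ?u \<otimes> inv t) \<otimes> inv g \<in> H"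
    using assms g by (simp add: m_assoc inv_mult_group)
  then have t: "g \<otimes> t \<otimes> inv g \<in> H"
    using malnormal_conj[of g t ?u] assms g u by simp
  then have "(g \<otimes> t \<otimes> inv g) \<otimes> (g \<otimes> ?u \<otimes> inv g) \<in> H"
    using g subgroup_H by (simp add: subgroup.m_closed)
  then have "g \<otimes> s \<otimes> inv g \<in> H"
    using assms g by (simp add: m_assoc)
  then show ?thesis
    using that g t by blast
qed

text \<open>
  Let \<open>i\<close> be the number of involutions of \<open>H\<close> and \<open>m\<close> the index. For an involution \<open>t\<close> of \<open>H\<close>, the products
  of \<open>t\<close> with itself and with the \<open>(m - 1) i\<close> involutions outside \<open>H\<close> are distinct elements of
  \<open>K\<close>. As \<open>|K| = m\<close>, this leaves only \<open>i \<le> 1\<close>.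
\<close>
lemma card_involutions_H: "card (involutions \<inter> H) = 1"
proof -
  let ?i = "card (involutions \<inter> H)"
  interpret H: group "G\<lparr>carrier := H\<rparr>"
    by (rule subgroup_imp_group[OF subgroup_H])
  obtain t where t: "t \<in> involutions" "t \<in> H"
    using H.cauchy[of 2] even_H unfolding involutions_def
    by (auto simp: order_def ord_subgroup[OF subgroup_H])
  have "(\<lambda>s. t \<otimes> s) ` insert t (involutions - H) \<subseteq> K"
  proof
    fix x
    assume "x \<in> (\<lambda>s. t \<otimes> s) ` insert t (involutions - H)"
    then obtain s where s: "x = t \<otimes> s" "s = t \<or> s \<in> involutions \<and> s \<notin> H"
      by auto
    show "x \<in> K"
    proof (rule ccontr)
      assume "x \<notin> K"
      with s have ts: "t \<otimes> s \<notin> K"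
        by simp
      have "s \<noteq> t"
        using ts t by auto
      with s have sI: "s \<in> involutions" "s \<notin> H"
        by simp_all
      obtain g where g: "g \<in> carrier G" "g \<otimes> t \<otimes> inv g \<in> H" "g \<otimes> s \<otimes> inv g \<in> H"
        using mult_involutions_outside_kernel[OF t(1) sI(1) ts] .
      have gH: "g \<in> H"
        using malnormal[of g t] g t involution_neq_one by blast
      then have "inv g \<otimes> (g \<otimes> s \<otimes> inv g) \<otimes> g \<in> H"
        using g subgroup_H by (simp add: subgroup.m_closed subgroup.m_inv_closed)
      then show False
        using g sI by (simp add: m_assoc)
    qed
  qed
  then have "card ((\<lambda>s. t \<otimes> s) ` insert t (involutions - H)) \<le> index"
    using card_mono[OF finite_K] card_K by metis
  moreover have "inj_on (\<lambda>s. t \<otimes> s) (insert t (involutions - H))"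
    using t by (intro inj_on_subset[OF inj_on_cmult]) auto
  ultimately have "card (insert t (involutions - H)) \<le> index"
    by (simp only: card_image)
  then have "card (involutions - H) + 1 \<le> index"
    using t by simp
  moreover have "card (involutions - H) + ?i = index * ?i"
    using card_involutions card_Int_Diff[of involutions H] by simp
  ultimately have "index * ?i + 1 \<le> index + ?i"
    by linarith
  moreover have "?i > 0"
    using t by (auto simp: card_gt_0_iff)
  moreover have "?i \<le> 1"
  proof (rule ccontr)
    assume "\<not> ?i \<le> 1"
    then obtain j where j: "?i = 2 + j"
      using le_Suc_ex[of 2 ?i] by auto
    obtain m where "index = 2 + m"
      using index_gt_1 le_Suc_ex[of 2 index] by auto
    with j \<open>index * ?i + 1 \<le> index + ?i\<close> show False
      by (simp add: algebra_simps)
  qed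
  ultimately show ?thesis
    by linarith
qed

lemma mult_involutions_in_kernel:
  assumes t: "t \<in> involutions" and s: "s \<in> involutions"
  shows "t \<otimes> s \<in> K"
proof (rule ccontr)
  assume nK: "t \<otimes> s \<notin> K"
  then obtain g where g: "g \<in> carrier G" "g \<otimes> t \<otimes> inv g \<in> H" "g \<otimes> s \<otimes> inv g \<in> H"
    using mult_involutions_outside_kernel t s by blast
  have "g \<otimes> t \<otimes> inv g = g \<otimes> s \<otimes> inv g"
    using card_involutions_H g conj_involution[of g] t s
    by (metis IntI card_1_singletonE singletonD)
  then have "t = s"
    using g t s by (simp add: m_assoc)
  then show False
    using nK t by simp
qed

text \<open>
  There are exactly as many involutions as elements of \<open>K\<close>.
\<close>
lemma kernel_eq_mult_involutions:
  assumes t: "t \<in> involutions"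
  shows "K = (\<lambda>s. t \<otimes> s) ` involutions"
proof -
  have "inj_on (\<lambda>s. t \<otimes> s) involutions"
    using t by (intro inj_on_subset[OF inj_on_cmult]) auto
  then have "card ((\<lambda>s. t \<otimes> s) ` involutions) = card K"
    by (simp add: card_image card_involutions card_involutions_H card_K)
  moreover have "(\<lambda>s. t \<otimes> s) ` involutions \<subseteq> K"
    using mult_involutions_in_kernel t by auto
  ultimately show ?thesis
    using card_subset_eq[OF finite_K] by metis
qed

lemma ex_involution: "\<exists>t. t \<in> involutions"
  using card_involutions_H by (metis IntD1 card_1_singletonE insertI1)

lemma involution_inverts_kernel:
  assumes "t \<in> involutions" "x \<in> K"
  shows "t \<otimes> x \<otimes> t = inv x"
proof -
  obtain s where "s \<in> involutions" "x = t \<otimes> s"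
    using assms kernel_eq_mult_involutions by blast
  then show ?thesis
    using assms by (simp add: inv_mult_group)
qed

text \<open>
  Write \<open>inv x = t s\<close> and \<open>y = t r\<close> with the same involution \<open>t\<close>; then \<open>x y = s t t r = s r\<close> is
  again a product of two involutions.
\<close>
lemma subgroup_kernel: "subgroup K G"
proof (rule subgroupI)
  show "K \<subseteq> carrier G" "K \<noteq> {}"
    using K_carrier one_K by blast+
  obtain t where t: "t \<in> involutions"
    using ex_involution by blast
  show inv: "inv x \<in> K" if x: "x \<in> K" for x
    using conj_in_kernel[OF x, of t] involution_inverts_kernel[OF t x] t by simp
  show "x \<otimes> y \<in> K" if x: "x \<in> K" and y: "y \<in> K" for x y
  proof -
    obtain s where s: "s \<in> involutions" "inv x = t \<otimes> s"
      using kernel_eq_mult_involutions[OF t] inv[OF x] by blast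
    obtain r where r: "r \<in> involutions" "y = t \<otimes> r"
      using kernel_eq_mult_involutions[OF t] y by blast
    have "x = s \<otimes> t"
      using s t K_carrier[OF x] by (metis inv_inv inv_involution inv_mult_group involution_closed)
    then have "x \<otimes> y = s \<otimes> r"
      using r s t by (simp add: m_assoc)
    then show ?thesis
      using mult_involutions_in_kernel r s by simp
  qed
qed

text \<open>
  Inversion on \<open>K\<close> is conjugation by an involution, hence a homomorphism.
\<close>
lemma comm_group_kernel: "comm_group (G\<lparr>carrier := K\<rparr>)"
proof -
  interpret K: group "G\<lparr>carrier := K\<rparr>"
    by (rule subgroup_imp_group[OF subgroup_kernel])
  obtain t where t: "t \<in> involutions"
    using ex_involution by blast
  have "x \<otimes> y = y \<otimes> x" if x: "x \<in> K" and y: "y \<in> K" for x y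
  proof -
    have xy: "y \<otimes> x \<in> K"
      using x y subgroup_kernel by (simp add: subgroup.m_closed)
    have "inv (y \<otimes> x) = (t \<otimes> y \<otimes> t) \<otimes> (t \<otimes> x \<otimes> t)"
      using involution_inverts_kernel[OF t xy] t K_carrier[OF x] K_carrier[OF y]
      by (simp add: m_assoc)
    also have "\<dots> = inv (x \<otimes> y)"
      using involution_inverts_kernel[OF t] x y K_carrier by (simp add: inv_mult_group)
    finally show ?thesis
      using x y K_carrier by (metis inv_inv m_closed)
  qed
  then show ?thesis
    by (intro K.group_comm_groupI) simp
qed

end

section \<open>Torsion in homocyclic groups\<close>

text \<open>
  For commutative groups this is the kernel of the \<open>n\<close>-th power map.
\<close>
definition (in group) torsion :: "nat \<Rightarrow> 'a set" where
  "torsion n = {x \<in> carrier G. x [^] n = \<one>}"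

lemma (in group) card_ord_prime_power:
  assumes "finite (carrier G)" "Factorial_Ring.prime p"
  shows "card {x \<in> carrier G. ord x = p ^ Suc i} = card (torsion (p ^ Suc i)) - card (torsion (p ^ i))"
proof -
  have *: "ord x = p ^ Suc i \<longleftrightarrow> ord x dvd p ^ Suc i \<and> \<not> ord x dvd p ^ i" for x
  proof (intro iffI conjI)
    assume x: "ord x = p ^ Suc i"
    then show "ord x dvd p ^ Suc i"
      by simp
    have "\<not> p ^ Suc i \<le> p ^ i"
      using prime_gt_1_nat[OF assms(2)] by simp
    then show "\<not> ord x dvd p ^ i"
      unfolding x using assms(2) prime_gt_0_nat by (auto dest!: dvd_imp_le)
  next
    assume x: "ord x dvd p ^ Suc i \<and> \<not> ord x dvd p ^ i"
    then obtain j where j: "j \<le> Suc i" "ord x = p ^ j"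
      using divides_primepow_nat[OF assms(2)] by blast
    then have "\<not> j \<le> i"
      using x le_imp_power_dvd by metis
    then show "ord x = p ^ Suc i"
      using j by (simp add: le_Suc_eq)
  qed
  have "{x \<in> carrier G. ord x = p ^ Suc i} = torsion (p ^ Suc i) - torsion (p ^ i)"
    unfolding torsion_def using pow_eq_id *[THEN iffD1] *[THEN iffD2] by blast
  moreover have "torsion (p ^ i) \<subseteq> torsion (p ^ Suc i)"
    unfolding torsion_def by (auto simp: pow_eq_id)
  ultimately show ?thesis
    using assms(1) by (simp add: card_Diff_subset torsion_def)
qed

lemma nat_pow_product_group:
  "v [^]\<^bsub>product_group I F\<^esub> (n::nat) = (\<lambda>i\<in>I. v i [^]\<^bsub>F i\<^esub> n)"
  by (induction n) (auto simp: fun_eq_iff)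

text \<open>
  The solutions are the multiples of \<open>p ^ (k - i)\<close>.
\<close>
lemma card_multiples_mod:
  fixes p :: nat
  assumes "p > 0" "i \<le> k"
  shows "card {z \<in> {0..<int (p ^ k)}. (int (p ^ i) * z) mod int (p ^ k) = 0} = p ^ i"
proof -
  have pk: "int (p ^ k) = int (p ^ i) * int (p ^ (k - i))"
    using assms by (simp flip: power_add)
  have pos: "int (p ^ i) > 0" "int (p ^ (k - i)) > 0"
    using assms by simp_all
  have "{z \<in> {0..<int (p ^ k)}. (int (p ^ i) * z) mod int (p ^ k) = 0} =
      (\<lambda>t. int (p ^ (k - i)) * t) ` {0..<int (p ^ i)}"
  proof (intro equalityI subsetI)
    fix z
    assume z: "z \<in> {z \<in> {0..<int (p ^ k)}. (int (p ^ i) * z) mod int (p ^ k) = 0}"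
    then have "int (p ^ i) * int (p ^ (k - i)) dvd int (p ^ i) * z"
      unfolding pk by auto
    then have "int (p ^ (k - i)) dvd z"
      using pos by (simp only: dvd_mult_cancel_left) linarith
    then obtain t where t: "z = int (p ^ (k - i)) * t"
      by blast
    have "int (p ^ (k - i)) * 0 \<le> int (p ^ (k - i)) * t" "int (p ^ (k - i)) * t < int (p ^ (k - i)) * int (p ^ i)"
      using z unfolding t pk by (simp_all add: mult.commute)
    then have "0 \<le> t" "t < int (p ^ i)"
      by (simp_all only: mult_le_cancel_left_pos[OF pos(2)] mult_less_cancel_left_pos[OF pos(2)])
    then show "z \<in> (\<lambda>t. int (p ^ (k - i)) * t) ` {0..<int (p ^ i)}"
      using t by auto
  next
    fix z
    assume "z \<in> (\<lambda>t. int (p ^ (k - i)) * t) ` {0..<int (p ^ i)}"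
    then obtain t where t: "z = int (p ^ (k - i)) * t" and "t \<in> {0..<int (p ^ i)}"
      by (rule imageE)
    then have t': "0 \<le> t" "t < int (p ^ i)"
      by simp_all
    have "int (p ^ (k - i)) * t < int (p ^ (k - i)) * int (p ^ i)"
      using t' pos(2) by (simp only: mult_less_cancel_left_pos)
    moreover have "int (p ^ i) * z = int (p ^ k) * t"
      unfolding pk t by simp
    ultimately show "z \<in> {z \<in> {0..<int (p ^ k)}. (int (p ^ i) * z) mod int (p ^ k) = 0}"
      using t t' pos unfolding pk by (auto simp: mult.commute)
  qed
  moreover have "inj_on (\<lambda>t. int (p ^ (k - i)) * t) {0..<int (p ^ i)}"
    using pos(2) by (auto intro: inj_onI)
  ultimately show ?thesis
    by (simp add: card_image nat_power_eq)
qed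

abbreviation homocyclic_group :: "nat \<Rightarrow> nat \<Rightarrow> (nat \<Rightarrow> int) monoid" where
  "homocyclic_group r n \<equiv> product_group {..<r} (\<lambda>_. integer_mod_group n)"

lemma group_homocyclic_group: "group (homocyclic_group r n)"
  by simp

lemma card_torsion_homocyclic_group:
  assumes "p > 0" "i \<le> k"
  shows "card (group.torsion (homocyclic_group r (p ^ k)) (p ^ i)) = (p ^ i) ^ r"
proof -
  let ?Z = "homocyclic_group r (p ^ k)"
  let ?T = "{z \<in> {0..<int (p ^ k)}. (int (p ^ i) * z) mod int (p ^ k) = 0}"
  have carrier: "carrier ?Z = ({..<r} \<rightarrow>\<^sub>E {0..<int (p ^ k)})"
    using assms by (simp add: carrier_integer_mod_group)
  have *: "v [^]\<^bsub>?Z\<^esub> (p ^ i) = \<one>\<^bsub>?Z\<^esub> \<longleftrightarrow>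
      (\<forall>j<r. (int (p ^ i) * v j) mod int (p ^ k) = 0)" if "v \<in> carrier ?Z" for v
    unfolding nat_pow_product_group by (auto simp: fun_eq_iff restrict_def)
  have "group.torsion ?Z (p ^ i) =
      {v \<in> carrier ?Z. \<forall>j<r. (int (p ^ i) * v j) mod int (p ^ k) = 0}"
    unfolding group.torsion_def[OF group_homocyclic_group]
    by (intro Collect_cong conj_cong refl *)
  also have "\<dots> = ({..<r} \<rightarrow>\<^sub>E ?T)"
    unfolding carrier PiE_def Pi_def by blast
  finally show ?thesis
    using card_multiples_mod[OF assms] by (simp add: card_PiE)
qed

lemma order_homocyclic_group:
  assumes "p > 0"
  shows "order (homocyclic_group r (p ^ k)) = (p ^ k) ^ r"
  using assms by (simp add: order_def carrier_integer_mod_group card_PiE nat_power_eq)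

lemma (in group_hom) card_image_mult_card_kernel:
  "card (h ` carrier G) * card (kernel G H h) = order G"
proof -
  let ?H = "H\<lparr>carrier := h ` carrier G\<rparr>"
  interpret img: group_hom G ?H h
  proof (intro group_hom.intro group_hom_axioms.intro)
    show "group ?H"
      by (rule H.subgroup_imp_group[OF img_is_subgroup])
    show "h \<in> hom G ?H"
      by (auto simp: hom_def)
  qed (rule G.is_group)
  have ker: "kernel G ?H h = kernel G H h"
    by (simp add: kernel_def)
  have "G Mod kernel G H h \<cong> ?H"
    using img.FactGroup_iso by (simp add: ker)
  then have "card (rcosets (kernel G H h)) = card (h ` carrier G)"
    using iso_same_card by (fastforce simp: FactGroup_def)
  then show ?thesis
    using G.lagrange[OF subgroup_kernel] by simp
qed

text \<open>
  The exponents that bring \<open>x\<close> into \<open>B\<close> are closed under greatest common divisors, and a proper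
  divisor of \<open>p ^ Suc k\<close> divides \<open>p ^ k\<close>. If \<open>x\<close> has order \<open>p ^ Suc k\<close>, this says that the cyclic
  group generated by \<open>x\<close> meets \<open>B\<close> trivially.
\<close>
lemma (in group) int_pow_in_subgroup_imp_dvd:
  assumes B: "subgroup B G" and x: "x \<in> carrier G" "x [^] (p ^ Suc k) \<in> B" "x [^] (p ^ k) \<notin> B"
    and p: "Factorial_Ring.prime (p::nat)" and n: "x [^] (n::int) \<in> B"
  shows "int (p ^ Suc k) dvd n"
proof -
  obtain u v where uv: "u * n + v * int (p ^ Suc k) = gcd n (int (p ^ Suc k))"
    using bezout_int by blast
  define d where "d = gcd (nat \<bar>n\<bar>) (p ^ Suc k)"
  have d: "int d = gcd n (int (p ^ Suc k))"
    by (simp add: d_def flip: gcd_int_int_eq)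
  have "x [^] int d = (x [^] n) [^] u \<otimes> (x [^] int (p ^ Suc k)) [^] v"
    unfolding d uv[symmetric] using x(1) by (simp add: int_pow_pow int_pow_mult mult.commute)
  also have "\<dots> \<in> B"
    unfolding int_pow_int[of G x "p ^ Suc k"]
    using subgroup_int_pow_closed[OF B n, of u] subgroup_int_pow_closed[OF B x(2), of v]
    by (rule subgroup.m_closed[OF B])
  finally have xd: "x [^] d \<in> B"
    by (simp add: int_pow_int)
  have "d dvd p ^ Suc k"
    unfolding d_def by (rule gcd_dvd2)
  then obtain i where i: "i \<le> Suc k" "d = p ^ i"
    using divides_primepow_nat[OF p, of d "Suc k"] by blast
  have "i = Suc k"
  proof (rule ccontr)
    assume "i \<noteq> Suc k"
    then obtain c where "p ^ k = d * c"
      using i le_imp_power_dvd[of i k p] by auto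
    then have "x [^] (p ^ k) = (x [^] d) [^] int c"
      using x(1) by (simp add: nat_pow_pow int_pow_int)
    then show False
      using subgroup_int_pow_closed[OF B xd] x(3) by simp
  qed
  then show ?thesis
    using i d by (metis gcd_dvd1)
qed

section \<open>A characterisation of homocyclic groups\<close>

text \<open>
  The new factor is mapped to the powers of \<open>x\<close>. By \<open>int_pow_in_subgroup_imp_dvd\<close> these meet the
  image of \<open>f\<close> only trivially, which gives injectivity.
\<close>
lemma (in comm_group) extend_hom_by_cyclic_factor:
  assumes f: "f \<in> hom (homocyclic_group r (p ^ Suc k)) G"
    and inj: "inj_on f (carrier (homocyclic_group r (p ^ Suc k)))"
    and p: "Factorial_Ring.prime p"
    and x: "x \<in> carrier G" "x [^] (p ^ Suc k) = \<one>"
      "x [^] (p ^ k) \<notin> f ` carrier (homocyclic_group r (p ^ Suc k))"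
  shows "\<exists>f'. f' \<in> hom (homocyclic_group (Suc r) (p ^ Suc k)) G \<and>
    inj_on f' (carrier (homocyclic_group (Suc r) (p ^ Suc k)))"
proof -
  let ?N = "p ^ Suc k"
  let ?Z = "homocyclic_group r ?N" and ?Z' = "homocyclic_group (Suc r) ?N"
  interpret Z: group_hom ?Z G f
    using f by (intro group_hom.intro group_hom_axioms.intro) (simp_all add: is_group)
  define f' where "f' v = f (restrict v {..<r}) \<otimes> x [^] v r" for v
  have restr: "restrict v {..<r} \<in> carrier ?Z" if "v \<in> carrier ?Z'" for v
    using that by (auto simp: PiE_iff)
  have last: "v r \<in> carrier (integer_mod_group ?N)" if "v \<in> carrier ?Z'" for v
    using that by (auto simp: PiE_iff)
  \<comment> \<open>Exponents of \<open>x\<close> matter only modulo \<open>p ^ Suc k\<close>, so the reduction in the last component is harmless.\<close>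
  have pow_mod: "x [^] (a mod int ?N) = x [^] a" for a :: int
  proof -
    have "int (ord x) dvd a - a mod int ?N"
      using x pow_eq_id[of x ?N] dvd_trans[of "int (ord x)" "int ?N" "a - a mod int ?N"]
      by (simp only: int_dvd_int_iff minus_mod_eq_mult_div dvd_triv_left)
    then show ?thesis
      using x(1) by (simp add: int_pow_eq)
  qed
  have "f' \<in> hom ?Z' G"
  proof (rule homI)
    fix v w
    assume v: "v \<in> carrier ?Z'" and w: "w \<in> carrier ?Z'"
    have r: "restrict (v \<otimes>\<^bsub>?Z'\<^esub> w) {..<r} = restrict v {..<r} \<otimes>\<^bsub>?Z\<^esub> restrict w {..<r}"
      by (auto simp: fun_eq_iff)
    have "x [^] (v \<otimes>\<^bsub>?Z'\<^esub> w) r = x [^] v r \<otimes> x [^] w r"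
      using x(1) pow_mod[of "v r + w r"] by (simp add: int_pow_mult)
    then show "f' (v \<otimes>\<^bsub>?Z'\<^esub> w) = f' v \<otimes> f' w"
      using restr[OF v] restr[OF w] x(1) unfolding f'_def r Z.hom_mult[OF restr[OF v] restr[OF w]]
      by (simp add: m_ac Z.hom_closed del: carrier_product_group)
  next
    fix v
    assume "v \<in> carrier ?Z'"
    then show "f' v \<in> carrier G"
      unfolding f'_def using restr Z.hom_closed x(1) by blast
  qed
  moreover have "inj_on f' (carrier ?Z')"
  proof -
    interpret Z': group_hom ?Z' G f'
      using \<open>f' \<in> hom ?Z' G\<close>
      by (intro group_hom.intro group_hom_axioms.intro) (simp_all add: is_group)
    have "v = \<one>\<^bsub>?Z'\<^esub>" if v: "v \<in> carrier ?Z'" and one: "f' v = \<one>" for v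
    proof -
      have fv: "f (restrict v {..<r}) \<in> f ` carrier ?Z"
        using restr[OF v] by (rule imageI)
      have B: "subgroup (f ` carrier ?Z) G"
        by (rule Z.img_is_subgroup)
      have "x [^] v r = inv (f (restrict v {..<r}))"
        using one x(1) Z.hom_closed[OF restr[OF v]] unfolding f'_def
        by (metis inv_equality int_pow_closed inv_inv)
      then have "x [^] v r \<in> f ` carrier ?Z"
        using subgroup.m_inv_closed[OF B fv] by simp
      moreover have "x [^] ?N \<in> f ` carrier ?Z"
        using subgroup.one_closed[OF B] x(2) by simp
      ultimately have "int ?N dvd v r"
        using int_pow_in_subgroup_imp_dvd[OF B x(1) _ x(3) p] by blast
      then have vr: "v r = 0"
        using last[OF v] prime_gt_0_nat[OF p]
        by (auto simp: carrier_integer_mod_group dest: zdvd_not_zless split: if_splits)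
          (metis int_ops(7) le_less of_nat_power zdvd_not_zless)
      then have "f (restrict v {..<r}) = \<one>"
        using one Z.hom_closed[OF restr[OF v]] unfolding f'_def by simp
      then have "restrict v {..<r} = \<one>\<^bsub>?Z\<^esub>"
        using inj restr[OF v] Z.inj_on_one_iff by blast
      then have "v i = 0" if "i < Suc r" for i
        using that vr by (auto simp: fun_eq_iff restrict_def less_Suc_eq split: if_splits)
      then show ?thesis
        using v by (auto simp: fun_eq_iff PiE_iff extensional_def)
    qed
    then show ?thesis
      unfolding Z'.inj_on_one_iff by blast
  qed
  ultimately show ?thesis
    by blast
qed

text \<open>
  The \<open>p ^ k\<close>-th power map sends \<open>G\<close> onto the elements of order dividing \<open>p\<close>, because its kernel has the right
  size. As long as an embedded homocyclic group of exponent \<open>p ^ Suc k\<close> has rank \<open>j < r\<close>, its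
  \<open>p ^ j\<close> elements of order dividing \<open>p\<close> miss some such element of \<open>G\<close>; a preimage of it under the
  power map generates a further independent factor. At rank \<open>r\<close> the orders agree.
\<close>
lemma (in comm_group) homocyclic_criterion:
  assumes fin: "finite (carrier G)" and p: "Factorial_Ring.prime p"
    and order: "order G = (p ^ r) ^ Suc k"
    and torsion_p: "card (torsion p) = p ^ r"
    and torsion_pk: "card (torsion (p ^ k)) = (p ^ r) ^ k"
    and exponent: "\<And>x. x \<in> carrier G \<Longrightarrow> x [^] (p ^ Suc k) = \<one>"
  shows "G \<cong> homocyclic_group r (p ^ Suc k)"
proof -
  let ?N = "p ^ Suc k"
  let ?pow = "\<lambda>x. x [^] (p ^ k)"
  have p0: "p > 0" and p1: "p > 1"
    using prime_gt_0_nat[OF p] prime_gt_1_nat[OF p] by auto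
  have "?pow ` carrier G = torsion p"
  proof -
    interpret pow: group_hom G G ?pow
      by (intro group_hom.intro group_hom_axioms.intro)
         (auto simp: is_group hom_def pow_mult_distrib m_comm)
    have "kernel G G ?pow = torsion (p ^ k)"
      by (simp add: kernel_def torsion_def)
    then have "card (?pow ` carrier G) * (p ^ r) ^ k = (p ^ r) * (p ^ r) ^ k"
      using pow.card_image_mult_card_kernel by (simp add: order torsion_pk)
    then have "card (?pow ` carrier G) = card (torsion p)"
      using p0 by (simp add: torsion_p)
    moreover have "?pow ` carrier G \<subseteq> torsion p"
      using exponent by (auto simp: torsion_def nat_pow_pow mult.commute)
    moreover have "finite (torsion p)"
      using fin by (simp add: torsion_def)
    ultimately show ?thesis
      using card_subset_eq by metis
  qed
  note lift = this
  have "\<exists>f. f \<in> hom (homocyclic_group j ?N) G \<and> inj_on f (carrier (homocyclic_group j ?N))"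
    if "j \<le> r" for j
    using that
  proof (induction j)
    case 0
    have "(\<lambda>_. \<one>) \<in> hom (homocyclic_group 0 ?N) G"
      by (auto simp: hom_def)
    then show ?case
      by (intro exI[of _ "\<lambda>_. \<one>"]) auto
  next
    case (Suc j)
    let ?Z = "homocyclic_group j ?N"
    obtain f where f: "f \<in> hom ?Z G" "inj_on f (carrier ?Z)"
      using Suc by auto
    interpret Z: group_hom ?Z G f
      using f by (intro group_hom.intro group_hom_axioms.intro) (simp_all add: is_group)
    have "f ` carrier ?Z \<inter> torsion p \<subseteq> f ` group.torsion ?Z p"
    proof
      fix y
      assume "y \<in> f ` carrier ?Z \<inter> torsion p"
      then obtain v where v: "v \<in> carrier ?Z" "y = f v" "f v [^] p = \<one>"
        by (auto simp: torsion_def simp del: carrier_product_group)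
      then have "f (v [^]\<^bsub>?Z\<^esub> p) = \<one>"
        using Z.hom_nat_pow[OF v(1), of p] by simp
      then have "v [^]\<^bsub>?Z\<^esub> p = \<one>\<^bsub>?Z\<^esub>"
        using f(2) Z.inj_on_one_iff group.is_monoid[OF group_homocyclic_group]
          monoid.nat_pow_closed v(1) by blast
      then show "y \<in> f ` group.torsion ?Z p"
        using v unfolding group.torsion_def[OF group_homocyclic_group] by blast
    qed
    moreover have card_tor: "card (group.torsion ?Z p) = p ^ j"
      using card_torsion_homocyclic_group[of p 1 "Suc k" j] p0 by simp
    moreover have "finite (group.torsion ?Z p)"
      using card_tor p0 card_gt_0_iff by (metis zero_less_power)
    ultimately have "card (f ` carrier ?Z \<inter> torsion p) \<le> p ^ j"
      using surj_card_le by metis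
    also have "p ^ j < card (torsion p)"
      unfolding torsion_p using Suc.prems p1 by (intro power_strict_increasing) auto
    finally have "\<not> torsion p \<subseteq> f ` carrier ?Z"
      by (metis inf.absorb_iff2 nat_neq_iff)
    then obtain x where x: "x \<in> carrier G" "?pow x \<notin> f ` carrier ?Z"
      unfolding lift[symmetric] by blast
    show ?case
      by (rule extend_hom_by_cyclic_factor[OF f p x(1) exponent[OF x(1)] x(2)])
  qed
  then obtain f where f: "f \<in> hom (homocyclic_group r ?N) G"
      "inj_on f (carrier (homocyclic_group r ?N))"
    by blast
  have "order (homocyclic_group r ?N) = order G"
    unfolding order order_homocyclic_group[OF p0] by (simp only: power_mult[symmetric] mult.commute)
  then have "card (f ` carrier (homocyclic_group r ?N)) = order G"
    using f(2) unfolding order_def[of "homocyclic_group r ?N"] by (simp only: card_image)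
  moreover have "f ` carrier (homocyclic_group r ?N) \<subseteq> carrier G"
    using f(1) by (auto simp: hom_def simp del: carrier_product_group)
  ultimately have "f ` carrier (homocyclic_group r ?N) = carrier G"
    using card_subset_eq[OF fin] by (simp add: order_def del: carrier_product_group)
  then have "f \<in> iso (homocyclic_group r ?N) G"
    using f unfolding iso_def bij_betw_def by blast
  then show ?thesis
    using group.iso_sym[OF group_homocyclic_group] is_isoI by blast
qed

section \<open>Order classes of abelian groups\<close>

text \<open>
  Raising \<open>a b\<close> to the power \<open>ord b\<close> eliminates \<open>b\<close>, and it preserves the order of \<open>a\<close> by coprimality.
\<close>
lemma (in comm_group) ord_mult_coprime:
  assumes "x \<in> carrier G" "y \<in> carrier G" "coprime (ord x) (ord y)"
  shows "ord (x \<otimes> y) = ord x * ord y"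
proof (rule dvd_antisym)
  show "ord (x \<otimes> y) dvd ord x * ord y"
    by (rule abelian_ord_mul_divides) fact+
  have *: "ord a dvd ord (a \<otimes> b)" if "a \<in> carrier G" "b \<in> carrier G" "coprime (ord a) (ord b)" for a b
  proof -
    have "(a \<otimes> b) [^] (ord (a \<otimes> b) * ord b) = \<one>"
      using that by (simp add: pow_eq_id)
    moreover have "b [^] (ord (a \<otimes> b) * ord b) = \<one>"
      using that by (simp add: pow_eq_id)
    ultimately have "a [^] (ord (a \<otimes> b) * ord b) = \<one>"
      using that pow_mult_distrib[OF m_comm[OF that(1,2)] that(1,2), of "ord (a \<otimes> b) * ord b"] by simp
    then have "ord a dvd ord (a \<otimes> b) * ord b"
      using that pow_eq_id by blast
    then show ?thesis
      using that coprime_dvd_mult_left_iff by blast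
  qed
  have "ord x dvd ord (x \<otimes> y)"
    using * assms by blast
  moreover have "ord y dvd ord (x \<otimes> y)"
    using *[of y x] assms by (simp add: m_comm coprime_commute)
  ultimately show "ord x * ord y dvd ord (x \<otimes> y)"
    using assms(3) by (rule divides_mult)
qed

text \<open>
  Every element of order \<open>m n\<close> factors uniquely as a product of elements of orders
  \<open>m\<close> and \<open>n\<close>; both factors are powers of it, with exponents from a Bezout identity.
\<close>
lemma (in comm_group) card_ord_mult_coprime:
  assumes "coprime m n"
  shows "card {z \<in> carrier G. ord z = m * n} =
    card {x \<in> carrier G. ord x = m} * card {y \<in> carrier G. ord y = n}"
proof -
  let ?E = "\<lambda>n. {x \<in> carrier G. ord x = n}"
  have "bij_betw (\<lambda>(x, y). x \<otimes> y) (?E m \<times> ?E n) (?E (m * n))"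
    unfolding bij_betw_def
  proof (intro conjI equalityI subsetI)
    show "inj_on (\<lambda>(x, y). x \<otimes> y) (?E m \<times> ?E n)"
    proof (rule inj_onI, clarify)
      fix a b x y
      assume a: "a \<in> carrier G" and b: "b \<in> carrier G" and x: "x \<in> carrier G" "ord x = ord a"
        and y: "y \<in> carrier G" "ord y = ord b" and eq: "a \<otimes> b = x \<otimes> y"
        and mn: "m = ord a" "n = ord b"
      let ?z = "inv x \<otimes> a"
      have "inv x \<otimes> (a \<otimes> b) = y"
        using eq x y by simp
      then have zy: "?z = y \<otimes> inv b"
        using a b x y by (simp add: inv_solve_right m_assoc)
      have "?z [^] ord a = \<one>"
        using a x pow_mult_distrib[OF m_comm, of "inv x" a "ord a"] pow_ord_eq_1[of "inv x"] by simp
      then have "ord ?z dvd ord a"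
        using a x by (simp add: pow_eq_id)
      moreover have "?z [^] ord b = \<one>"
        unfolding zy using b y pow_mult_distrib[OF m_comm, of y "inv b" "ord b"]
          pow_ord_eq_1[of "inv b"] pow_ord_eq_1[of y] by simp
      then have "ord ?z dvd ord b"
        using a x by (simp add: pow_eq_id)
      ultimately have "is_unit (ord ?z)"
        using assms unfolding mn by (rule coprime_common_divisor[rotated])
      then have z: "?z = \<one>"
        using a x ord_eq_1[of ?z] by simp
      then have "a = x"
        using a x by (simp add: inv_solve_left')
      moreover have "b = y"
        using inv_equality[of y "inv b"] z zy b y by simp
      ultimately show "a = x \<and> b = y" ..
    qed
  next
    fix z
    assume "z \<in> (\<lambda>(x, y). x \<otimes> y) ` (?E m \<times> ?E n)"
    then obtain x y where "x \<in> carrier G" "y \<in> carrier G" "ord x = m" "ord y = n" "z = x \<otimes> y"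
      by auto
    then show "z \<in> ?E (m * n)"
      using ord_mult_coprime[of x y] assms by simp
  next
    fix z
    assume "z \<in> ?E (m * n)"
    then have z: "z \<in> carrier G" "ord z = m * n"
      by simp_all
    obtain u v :: int where uv: "u * int m + v * int n = 1"
      using bezout_int[of "int m" "int n"] assms by auto
    let ?x = "z [^] (v * int n)" and ?y = "z [^] (u * int m)"
    have xy: "z = ?x \<otimes> ?y"
      using z uv by (simp add: add.commute flip: int_pow_mult)
    have "?x [^] m = z [^] (v * int (m * n))" "?y [^] n = z [^] (u * int (m * n))"
      using z by (simp_all add: int_pow_pow mult_ac flip: int_pow_int)
    then have "?x [^] m = \<one>" "?y [^] n = \<one>"
      using z by (simp_all add: int_pow_eq_id)
    then have dvd: "ord ?x dvd m" "ord ?y dvd n"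
      using z by (simp_all add: pow_eq_id)
    then have "coprime (ord ?x) (ord ?y)"
      using assms coprime_divisors by blast
    then have eq: "ord ?x * ord ?y = m * n"
      using ord_mult_coprime[of ?x ?y] z xy by simp
    have "m dvd ord ?x * ord ?y" "n dvd ord ?x * ord ?y"
      unfolding eq by simp_all
    moreover have "coprime m (ord ?y)" "coprime n (ord ?x)"
      using assms dvd coprime_divisors[of m m "ord ?y" n] coprime_divisors[of "ord ?x" m n n]
      by (simp_all add: coprime_commute)
    ultimately have "m dvd ord ?x" "n dvd ord ?y"
      by (simp_all add: coprime_dvd_mult_left_iff coprime_dvd_mult_right_iff)
    then have "?x \<in> ?E m" "?y \<in> ?E n"
      using z dvd dvd_antisym by auto
    then show "z \<in> (\<lambda>(x, y). x \<otimes> y) ` (?E m \<times> ?E n)"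
      using xy by (intro image_eqI[of _ _ "(?x, ?y)"]) auto
  qed
  then have "card (?E m \<times> ?E n) = card (?E (m * n))"
    by (rule bij_betw_same_card)
  then show ?thesis
    by (simp add: card_cartesian_product)
qed

lemma (in comm_group) subgroup_torsion: "subgroup (torsion n) G"
  unfolding torsion_def
  by (rule subgroupI) (auto simp: nat_pow_inv pow_mult_distrib m_comm)

text \<open>
  A second prime \<open>q\<close> would make \<open>b\<^sup>2\<close> divide the size of the class of elements of order
  \<open>p q\<close>, hence \<open>b\<close> divide the order of the group.
\<close>
lemma (in comm_group) prime_power_order_if_order_classes:
  assumes fin: "finite (carrier G)" and b: "b > 1" "coprime b (order G)"
    and classes: "\<And>n. n > 1 \<Longrightarrow> card {x \<in> carrier G. ord x = n} = 0 \<or>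
      b dvd card {x \<in> carrier G. ord x = n} \<and> card {x \<in> carrier G. ord x = n} dvd order G * b"
    and p: "Factorial_Ring.prime p" "p dvd order G"
  shows "\<exists>n. order G = p ^ n"
proof -
  define c where "c n = card {x \<in> carrier G. ord x = n}" for n
  have c: "c n = 0 \<or> b dvd c n \<and> c n dvd order G * b" if "n > 1" for n
    using classes[OF that] unfolding c_def .
  have cauchy_c: "c q \<noteq> 0" if q: "Factorial_Ring.prime q" "q dvd order G" for q
  proof -
    obtain x where "x \<in> carrier G" "ord x = q"
      using cauchy[OF fin q] by blast
    then show ?thesis
      using fin unfolding c_def by auto
  qed
  have unique: "q = p" if q: "Factorial_Ring.prime q" "q dvd order G" for q
  proof (rule ccontr)
    assume "q \<noteq> p"
    then have "coprime p q"
      using p q by (simp add: primes_coprime)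
    then have cpq: "c (p * q) = c p * c q"
      unfolding c_def by (rule card_ord_mult_coprime)
    have "p > 1" "q > 1"
      using p q prime_gt_1_nat by auto
    then have "p * q > 1"
      by (rule less_1_mult)
    have "b * b dvd c p * c q"
      using c[OF \<open>p > 1\<close>] c[OF \<open>q > 1\<close>] cauchy_c p q by (intro mult_dvd_mono) auto
    also have "\<dots> dvd order G * b"
      using c[OF \<open>p * q > 1\<close>] cauchy_c[OF p] cauchy_c[OF q] unfolding cpq by simp
    finally have "b dvd order G"
      using b(1) by simp
    then show False
      using b coprime_common_divisor[OF b(2), of b] by simp
  qed
  have "order G \<noteq> 0"
    using fin order_gt_0_iff_finite by simp
  then obtain m where m: "\<not> p dvd m" "order G = p ^ multiplicity p (order G) * m"
    using multiplicity_decompose'[of "order G" p] not_prime_unit p(1) by metis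
  \<comment> \<open>Any prime divisor of the part of the order prime to \<open>p\<close> would be a second prime divisor of the order.\<close>
  have "m = 1"
  proof (rule ccontr)
    assume "m \<noteq> 1"
    then obtain q where q: "Factorial_Ring.prime q" "q dvd m"
      using prime_factor_nat by blast
    moreover have "q dvd order G"
      using q(2) by (subst m(2)) simp
    ultimately show False
      using unique m(1) by metis
  qed
  then show ?thesis
    using m(2) by auto
qed

text \<open>
  Uniqueness of the part prime to \<open>p\<close>.
\<close>
lemma prime_power_mult_coprime_unique:
  fixes p :: nat
  assumes "p ^ s * u = b * p ^ a" "coprime u p" "coprime b p"
  shows "u = b"
proof (rule dvd_antisym)
  have "u dvd b * p ^ a" "b dvd p ^ s * u"
    using assms(1) by (metis dvd_triv_right, metis dvd_triv_left)
  then show "u dvd b" "b dvd u"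
    using assms(2,3) by (simp_all add: coprime_dvd_mult_left_iff coprime_dvd_mult_right_iff)
qed

text \<open>
  In the application \<open>b\<close> is the order of the Frobenius complement. The layers of the filtration by
  \<open>p ^ i\<close>-torsion all turn out to have size \<open>b + 1\<close>, up to the exponent of the group.
\<close>
lemma (in comm_group) homocyclic_if_order_classes:
  assumes fin: "finite (carrier G)" and nontriv: "carrier G \<noteq> {\<one>}"
    and b: "b > 1" "coprime b (order G)"
    and classes: "\<And>n. n > 1 \<Longrightarrow> card {x \<in> carrier G. ord x = n} = 0 \<or>
      b dvd card {x \<in> carrier G. ord x = n} \<and> card {x \<in> carrier G. ord x = n} dvd order G * b"
  shows "\<exists>p r. Factorial_Ring.prime p \<and> p dvd order G \<and> homocyclic p r G \<and> b = p ^ r - 1"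
proof -
  have "order G \<noteq> 1"
    using nontriv order_one_triv_iff by blast
  then obtain p where p: "Factorial_Ring.prime p" "p dvd order G"
    using prime_factor_nat by blast
  have p1: "p > 1" and p0: "p > 0"
    using prime_gt_1_nat[OF p(1)] by simp_all
  obtain n where n: "order G = p ^ n"
    using prime_power_order_if_order_classes[OF fin b classes p] by blast
  have bp: "coprime b p"
    using b(2) p(2) coprime_divisors[of b b p "order G"] by simp
  have ord_pow_p: "\<exists>j. ord x = p ^ j" if "x \<in> carrier G" for x
    using ord_dvd_group_order[OF that] divides_primepow_nat[OF p(1)] unfolding n by blast
  define T where "T i = card (torsion (p ^ i))" for i
  have finite_torsion: "finite (torsion m)" for m
    using fin by (simp add: torsion_def)
  have T_pow: "\<exists>s. T i = p ^ s" for i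
  proof -
    have "T i dvd order G"
      unfolding T_def using lagrange[OF subgroup_torsion, of "p ^ i"] by (metis dvd_triv_right)
    then show ?thesis
      using divides_primepow_nat[OF p(1)] unfolding n by blast
  qed
  define exponent where "exponent k \<longleftrightarrow> (\<forall>x\<in>carrier G. x [^] (p ^ k) = \<one>)" for k
  \<comment> \<open>So \<open>p ^ k\<close> is the exponent of the group.\<close>
  define k where "k = (LEAST k. exponent k)"
  have "exponent n"
    unfolding exponent_def using pow_order_eq_1 n by simp
  then have k: "exponent k" and k_least: "\<And>i. i < k \<Longrightarrow> \<not> exponent i"
    unfolding k_def by (auto intro: LeastI dest: not_less_Least)
  have T0: "T 0 = 1"
  proof -
    have "torsion (p ^ 0) = {\<one>}"
      by (auto simp: torsion_def)
    then show ?thesis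
      unfolding T_def by simp
  qed
  have step: "T (Suc i) = T i * (b + 1) \<and> (\<exists>r>0. b + 1 = p ^ r)" if ik: "i < k" for i
  proof -
    obtain x where x: "x \<in> carrier G" "x [^] (p ^ i) \<noteq> \<one>"
      using k_least[OF ik] unfolding exponent_def by blast
    obtain j where j: "ord x = p ^ j"
      using ord_pow_p x by blast
    have "\<not> j \<le> i"
      using x j le_imp_power_dvd[of j i p] by (auto simp: pow_eq_id)
    then have ji: "j = (j - Suc i) + Suc i"
      by simp
    have "ord (x [^] (p ^ (j - Suc i))) = p ^ Suc i"
    proof -
      have "p ^ j = p ^ (j - Suc i) * p ^ Suc i"
        by (subst ji) (rule power_add)
      then show ?thesis
        using ord_pow[OF x(1), of "p ^ (j - Suc i)"] j p0 by simp
    qed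
    then have ne: "card {x \<in> carrier G. ord x = p ^ Suc i} \<noteq> 0"
      using fin x(1) nat_pow_closed by (auto simp del: power_Suc)
    have card_eq: "card {x \<in> carrier G. ord x = p ^ Suc i} = T (Suc i) - T i"
      unfolding T_def by (rule card_ord_prime_power[OF fin p(1)])
    have "p ^ Suc i > 1"
      using p1 by (rule one_less_power) simp
    then have bdvd: "b dvd T (Suc i) - T i" "T (Suc i) - T i dvd order G * b"
      using classes[of "p ^ Suc i"] ne unfolding card_eq by auto
    then obtain d where d: "T (Suc i) - T i = b * d"
      by blast
    have "d dvd order G"
      using bdvd(2) b(1) unfolding d by (simp add: mult.commute)
    then obtain a where a: "d = p ^ a"
      using divides_primepow_nat[OF p(1)] unfolding n by blast
    obtain s s' where s: "T i = p ^ s" "T (Suc i) = p ^ s'"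
      using T_pow by metis
    have "p ^ s < p ^ s'"
      using ne unfolding card_eq s by simp
    then have "s < s'"
      using p1 power_less_imp_less_exp by blast
    define t where "t = s' - s"
    have t: "t > 0" "T (Suc i) = p ^ s * p ^ t"
      using \<open>s < s'\<close> s by (simp_all add: t_def flip: power_add)
    \<comment> \<open>Both \<open>p ^ t - 1\<close> and \<open>b\<close> are prime to \<open>p\<close>, so they coincide.\<close>
    have "p ^ s * (p ^ t - 1) = b * p ^ a"
      using d t s a by (simp add: diff_mult_distrib2)
    moreover have "coprime (p ^ t - 1) p"
    proof -
      have "coprime (p ^ t - 1) (p ^ t)"
        using p0 by (intro coprime_diff_one_left_nat) simp
      then show ?thesis
        using t(1) by simp
    qed
    ultimately have "p ^ t - 1 = b"
      using bp by (rule prime_power_mult_coprime_unique)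
    then have "b + 1 = p ^ t"
      using b(1) by linarith
    then show ?thesis
      using t s by auto
  qed
  have "k \<noteq> 0"
  proof
    assume "k = 0"
    then have "carrier G \<subseteq> {\<one>}"
      using k unfolding exponent_def by auto
    then show False
      using nontriv one_closed by blast
  qed
  then obtain l where l: "k = Suc l"
    using not0_implies_Suc by blast
  obtain r where r: "r > 0" "b + 1 = p ^ r"
    using step[of 0] l by auto
  have T: "T i = (p ^ r) ^ i" if "i \<le> k" for i
    using that
  proof (induction i)
    case (Suc i)
    then have "T (Suc i) = T i * (b + 1)"
      using step[of i] by simp
    then show ?case
      unfolding r(2) using Suc by simp
  qed (simp add: T0)
  have "torsion (p ^ k) = carrier G"
    using k unfolding torsion_def exponent_def by auto
  then have "order G = (p ^ r) ^ Suc l"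
    using T[of k] l unfolding T_def order_def by simp
  moreover have "card (torsion p) = p ^ r" "card (torsion (p ^ l)) = (p ^ r) ^ l"
    using T[of 1] T[of l] l unfolding T_def by simp_all
  moreover have "x [^] (p ^ Suc l) = \<one>" if "x \<in> carrier G" for x
    using k that unfolding l exponent_def by blast
  ultimately have "G \<cong> homocyclic_group r (p ^ Suc l)"
    by (intro homocyclic_criterion[OF fin p(1)])
  then have "homocyclic p r G"
    unfolding homocyclic_def using r(1) by blast
  then show ?thesis
    using p r(2) b(1) by (intro exI[of _ p] exI[of _ r]) auto
qed

text \<open>
  The elements of order \<open>p ^ (i + 1)\<close> number \<open>p ^ ((i + 1) r) - p ^ (i r)\<close>, which is
  \<open>p ^ (i r)\<close> times \<open>p ^ r - 1\<close>.
\<close>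
lemma (in group) homocyclic_order_classes:
  assumes p: "Factorial_Ring.prime p" and fin: "finite (carrier G)"
    and iso: "G \<cong> homocyclic_group r (p ^ k)" and n: "n > 1"
  shows "card {x \<in> carrier G. ord x = n} = 0 \<or>
    card {x \<in> carrier G. ord x = n} dvd order G * (p ^ r - 1)"
  unfolding disj_imp
proof (rule impI)
  assume ne: "card {x \<in> carrier G. ord x = n} \<noteq> 0"
  let ?Z = "homocyclic_group r (p ^ k)"
  have p0: "p > 0"
    using p prime_gt_0_nat by blast
  obtain h where h: "h \<in> iso G ?Z"
    using iso unfolding is_iso_def by blast
  interpret h: group_hom G ?Z h
    using h by (intro group_hom.intro group_hom_axioms.intro) (simp_all add: is_group iso_def)
  have bij: "bij_betw h (carrier G) (carrier ?Z)"
    using h by (simp add: iso_def)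
  have hom_pow: "h (x [^] m) = h x [^]\<^bsub>?Z\<^esub> m" if "x \<in> carrier G" for x and m :: nat
    using h.hom_nat_pow[OF that] .
  have "x [^] m = \<one> \<longleftrightarrow> h x [^]\<^bsub>?Z\<^esub> m = \<one>\<^bsub>?Z\<^esub>" if x: "x \<in> carrier G" for x and m :: nat
    using bij_betw_imp_inj_on[OF bij] h.inj_on_one_iff hom_pow[OF x, of m] nat_pow_closed[OF x, of m] h.hom_one
    by metis
  then have "bij_betw h (torsion m) (group.torsion ?Z m)" for m
    unfolding torsion_def group.torsion_def[OF group_homocyclic_group]
    by (intro bij_betw_Collect[OF bij]) simp
  then have card_T: "card (torsion m) = card (group.torsion ?Z m)" for m
    by (rule bij_betw_same_card)
  have T: "card (torsion (p ^ i)) = (p ^ i) ^ r" if "i \<le> k" for i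
    unfolding card_T by (rule card_torsion_homocyclic_group[OF p0 that])
  have order: "order G = (p ^ k) ^ r"
    using bij_betw_same_card[OF bij] order_homocyclic_group[OF p0, of r k]
    unfolding order_def by (simp only:)
  have "torsion (p ^ k) = carrier G"
    using T[of k] order fin unfolding order_def
    by (intro card_subset_eq) (auto simp: torsion_def)
  moreover obtain x where x: "x \<in> carrier G" "ord x = n"
    using ne by (metis (mono_tags, lifting) card.empty empty_Collect_eq)
  ultimately have "n dvd p ^ k"
    using pow_eq_id unfolding torsion_def by blast
  then obtain j where j: "j \<le> k" "n = p ^ j"
    using divides_primepow_nat[OF p] by blast
  then obtain i where i: "j = Suc i"
    using n by (cases j) auto
  have "card {x \<in> carrier G. ord x = n} = (p ^ Suc i) ^ r - (p ^ i) ^ r"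
    unfolding j(2) i card_ord_prime_power[OF fin p] using T[of i] T[of "Suc i"] j(1) i by simp
  also have "\<dots> = (p ^ i) ^ r * (p ^ r - 1)"
    by (simp add: diff_mult_distrib2 power_mult_distrib mult.commute)
  also have "\<dots> dvd order G * (p ^ r - 1)"
    unfolding order using j(1) i by (intro mult_dvd_mono dvd_power_same le_imp_power_dvd) auto
  finally show "card {x \<in> carrier G. ord x = n} dvd order G * (p ^ r - 1)" .
qed

section \<open>Frobenius groups with perfect order classes\<close>

lemma (in finite_frobenius_group) homocyclic_kernel_if_perfect:
  assumes "perfect_order_classes G"
  shows "\<exists>p r. Factorial_Ring.prime p \<and> odd p \<and> homocyclic p r (G\<lparr>carrier := K\<rparr>) \<and>
    card H = p ^ r - 1"
proof -
  let ?KG = "G\<lparr>carrier := K\<rparr>"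
  have H_perfect: "perfect_order_classes (G\<lparr>carrier := H\<rparr>)"
    and K_classes: "\<And>n. n > 1 \<Longrightarrow>
      card {x \<in> K. ord x = n} = 0 \<or> card {x \<in> K. ord x = n} dvd index * card H"
    using assms perfect_order_classes_iff by blast+
  have "even (order (G\<lparr>carrier := H\<rparr>))"
    by (rule group.perfect_order_classes_even[OF subgroup_imp_group[OF subgroup_H] _ _ H_perfect])
       (use card_H_gt_1 in auto)
  then have even: "even (card H)"
    by (simp add: order_def)
  interpret even_frobenius_group G H K
    by unfold_locales (rule even)
  interpret K: comm_group ?KG
    by (rule comm_group_kernel)
  have order_K: "order ?KG = index"
    by (simp add: order_def card_K)
  have K_class: "{x \<in> carrier ?KG. group.ord ?KG x = n} = {x \<in> K. ord x = n}" for n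
    using ord_subgroup[OF subgroup_kernel] by auto
  have "\<exists>p r. Factorial_Ring.prime p \<and> p dvd order ?KG \<and> homocyclic p r ?KG \<and> card H = p ^ r - 1"
  proof (rule K.homocyclic_if_order_classes)
    show "carrier ?KG \<noteq> {\<one>\<^bsub>?KG\<^esub>}"
      using index_gt_1 card_K by auto
    show "card {x \<in> carrier ?KG. K.ord x = n} = 0 \<or>
        card H dvd card {x \<in> carrier ?KG. K.ord x = n} \<and>
        card {x \<in> carrier ?KG. K.ord x = n} dvd order ?KG * card H" if "n > 1" for n
      using K_classes[OF that] card_H_dvd_card_kernel_ord[of n] that
      unfolding K_class order_K by simp
  qed (use card_H_gt_1 coprime_card_H_index order_K in simp_all)
  then obtain p r where p: "Factorial_Ring.prime p" "p dvd index" "homocyclic p r ?KG"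
      "card H = p ^ r - 1"
    unfolding order_K by blast
  have "odd p"
  proof
    assume "even p"
    then have "even index"
      using p(2) by (rule dvd_trans)
    then show False
      using coprime_common_divisor[OF coprime_card_H_index even] by simp
  qed
  then show ?thesis
    using p by blast
qed

text \<open>
  A Sylow \<open>p\<close>-subgroup has trivial intersection with the conjugates of \<open>H\<close>, so it is contained in
  \<open>K\<close>, and it has the same size.
\<close>
lemma (in finite_frobenius_group) kernel_eq_sylow_subgroup:
  assumes p: "Factorial_Ring.prime p" and card_K_eq: "card K = p ^ n" and "\<not> p dvd card H"
  shows "subgroup K G"
proof -
  obtain P where P: "subgroup P G" "card P = p ^ n"
    using sylow_thm[OF p is_group _ finite_carrier, of n "card H"] order_G card_K card_K_eq by auto
  interpret P: group "G\<lparr>carrier := P\<rparr>"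
    by (rule subgroup_imp_group) fact
  have "P \<subseteq> K"
  proof
    fix x
    assume x: "x \<in> P"
    have xG: "x \<in> carrier G"
      using P(1) x by (rule subgroup.mem_carrier)
    have "ord x dvd p ^ n"
      using P.ord_dvd_group_order[of x] x P by (simp add: ord_subgroup order_def)
    show "x \<in> K"
    proof (rule ccontr)
      assume "x \<notin> K"
      then obtain g where g: "g \<in> carrier G" "g \<otimes> x \<otimes> inv g \<in> H" and "x \<noteq> \<one>"
        using xG unfolding kernel_iff by blast
      have "ord x dvd card H"
        using ord_H_dvd[OF g(2)] ord_conj[OF g(1) xG] by simp
      moreover have "coprime (p ^ n) (card H)"
        using prime_imp_coprime[OF p] assms(3) by simp
      ultimately have "is_unit (ord x)"
        using \<open>ord x dvd p ^ n\<close> coprime_common_divisor by blast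
      then show False
        using \<open>x \<noteq> \<one>\<close> ord_eq_1[OF xG] by simp
    qed
  qed
  then have "P = K"
    using P(2) card_K_eq by (intro card_subset_eq) simp_all
  then show ?thesis
    using P(1) by simp
qed

text \<open>
  A bijection from \<open>K\<close> that respects products does not by itself make \<open>K\<close> closed under
  multiplication. The hypothesis is therefore first used only for the order of \<open>K\<close>, from which
  \<open>kernel_eq_sylow_subgroup\<close> yields that \<open>K\<close> is a subgroup.
\<close>
lemma (in finite_frobenius_group) perfect_if_homocyclic_kernel:
  assumes H_perfect: "perfect_order_classes (G\<lparr>carrier := H\<rparr>)"
    and p: "Factorial_Ring.prime p" and homocyclic: "homocyclic p r (G\<lparr>carrier := K\<rparr>)"
    and card_H: "card H = p ^ r - 1"
  shows "perfect_order_classes G"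
proof -
  let ?KG = "G\<lparr>carrier := K\<rparr>"
  obtain k where r: "r > 0" and iso: "?KG \<cong> homocyclic_group r (p ^ k)"
    using homocyclic unfolding homocyclic_def by blast
  have p0: "p > 0"
    using p prime_gt_0_nat by blast
  have "card K = card (carrier (homocyclic_group r (p ^ k)))"
    using iso_same_card[OF iso] by (simp del: carrier_product_group)
  also have "\<dots> = p ^ (k * r)"
    using order_homocyclic_group[OF p0, of r k] unfolding order_def by (simp only: power_mult)
  finally have card_K_eq: "card K = p ^ (k * r)" .
  \<comment> \<open>Here \<open>r > 0\<close> matters: for \<open>r = 0\<close> the right-hand side \<open>p ^ r - 1\<close> would be \<open>0\<close>.\<close>
  have "\<not> p dvd card H"
  proof
    assume "p dvd card H"
    moreover have "p dvd p ^ r"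
      using r by simp
    moreover have "card H + 1 = p ^ r"
      using card_H p0 by simp
    ultimately have "p dvd 1"
      using dvd_add_right_iff by metis
    then show False
      using p by simp
  qed
  then have K: "subgroup K G"
    by (rule kernel_eq_sylow_subgroup[OF p card_K_eq])
  interpret K: group ?KG
    by (rule subgroup_imp_group[OF K])
  have "card {x \<in> K. ord x = n} = 0 \<or> card {x \<in> K. ord x = n} dvd index * card H" if "n > 1" for n
  proof -
    have "{x \<in> carrier ?KG. group.ord ?KG x = n} = {x \<in> K. ord x = n}"
      using ord_subgroup[OF K] by auto
    moreover have "order ?KG = index"
      by (simp add: order_def card_K)
    ultimately show ?thesis
      using K.homocyclic_order_classes[OF p _ iso that] unfolding card_H by simp
  qed
  then show ?thesis
    using H_perfect perfect_order_classes_iff by blast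
qed

theorem theoremA:
  fixes G :: "('a, 'b) monoid_scheme" and K H :: "'a set"
  assumes "finite (carrier G)"
    and "frobenius_group G K H"
  shows "perfect_order_classes G \<longleftrightarrow>
    perfect_order_classes (G\<lparr>carrier := H\<rparr>) \<and>
    (\<exists>p r :: nat. Factorial_Ring.prime p \<and> odd p \<and>
       homocyclic p r (G\<lparr>carrier := K\<rparr>) \<and>
       card H = p ^ r - 1)"
proof -
  interpret finite_frobenius_group G H K
    using assms unfolding frobenius_group_def
    by (intro finite_frobenius_group.intro finite_frobenius_group_axioms.intro) auto
  show ?thesis
    using perfect_order_classes_iff homocyclic_kernel_if_perfect perfect_if_homocyclic_kernel
    by blast
qed

end
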